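(* Let $S',T',K$ be mutually independent discrete random variables on finite alphabets, let $S=(S',K)$ and $T=(T',K)$, and let $p(y_1y_2|x_1x_2)$ be a discrete memoryless interference channel with finite alphabets. Then the source pair $(S,T)$ can be transmitted losslessly over this channel (i.e. $(S,T)$ is admissible for it) if there exist auxiliary random variables $W_0,W_1,W_2$ (on finite alphabets) and channel inputs $X_1,X_2$ such that the joint distribution of all variables factors as (with $s=(s',k)$, $t=(t',k)$) $$p(s,t,w_0,w_1,w_2,x_1,x_2,y_1,y_2)=p(s')\,p(t')\,p(k)\,p(w_0)\,p(w_1|w_0)\,p(w_2|w_0)\,p(x_1|w_0,w_1)\,p(x_2|w_0,w_2)\,p(y_1y_2|x_1x_2)$$ and \begin{align*} H(S')&<I(X_1;Y_1|W_0W_2),\\ H(T')&<I(X_2;Y_2|W_0W_1),\\ H(K)+H(S')&<I(W_0W_2X_1;Y_1),\\ H(K)+H(T')&<I(W_0W_1X_2;Y_2),\\ H(S')+H(T')&<I(X_1;Y_1|W_0W_1W_2)+I(W_1X_2;Y_2|W_0),\\ H(S')+H(T')&<I(X_2;Y_2|W_0W_1W_2)+I(W_2X_1;Y_1|W_0),\\ H(S')+H(T')&<I(W_2X_1;Y_1|W_0W_1)+I(W_1X_2;Y_2|W_0W_2),\\ H(K)+H(S')+H(T')&<I(W_0W_1X_2;Y_2)+I(X_1;Y_1|W_0W_1W_2),\\ H(K)+H(S')+H(T')&<I(W_0W_2X_1;Y_1)+I(X_2;Y_2|W_0W_1W_2),\\ 2H(S')+H(T')&<I(X_1;Y_1|W_0W_1W_2)+I(W_2X_1;Y_1|W_0)+I(W_1X_2;Y_2|W_0W_2),\\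 H(S')+2H(T')&<I(X_2;Y_2|W_0W_1W_2)+I(W_1X_2;Y_2|W_0)+I(W_2X_1;Y_1|W_0W_1),\\ H(K)+2H(S')+H(T')&<I(X_1;Y_1|W_0W_1W_2)+I(W_0W_2X_1;Y_1)+I(W_1X_2;Y_2|W_0W_2),\\ H(K)+H(S')+2H(T')&<I(X_2;Y_2|W_0W_1W_2)+I(W_0W_1X_2;Y_2)+I(W_2X_1;Y_1|W_0W_1). \end{align*}
   Context: Juxtaposition of random variables inside $H(\cdot)$ and $I(\cdot;\cdot|\cdot)$ denotes the tuple, e.g. $I(W_2X_1;Y_1|W_0W_1)=I((W_2,X_1);Y_1|(W_0,W_1))$. $H$ and $I$ are Shannon entropy and (conditional) mutual information. All alphabets are finite; $\mathcal S,\mathcal T$ denote the alphabets of $S,T$. Source: $(S^n,T^n)$ is i.i.d., $p(s^n,t^n)=\prod_{i=1}^n p(s_i,t_i)$. Channel: a discrete memoryless interference channel (DMIC) is a transition probability $p(y_1y_2|x_1x_2)$ with finite input alphabets $\mathcal X_1,\mathcal X_2$ and output alphabets $\mathcal Y_1,\mathcal Y_2$; over $n$ uses, $p(y_1^n y_2^n|x_1^n x_2^n)=\prod_{i=1}^n p(y_{1i}y_{2i}|x_{1i}x_{2i})$. Code: a length-$n$ source-channel block code consists of encoders $f_1:\mathcal S^n\to\mathcal X_1^n$, $f_2:\mathcal T^n\to\mathcal X_2^n$ and decoders $\phi_1:\mathcal Y_1^n\to\mathcal S^n$, $\phi_2:\mathcal Y_2^n\to\mathcal T^n$. The channel inputs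 are $X_1^n=f_1(S^n)$ and $X_2^n=f_2(T^n)$. The error probabilities are $P_{e1}=\sum_{s^n}p(s^n)\Pr\{s^n\ne\phi_1(Y_1^n)\mid S^n=s^n\}$ and $P_{e2}=\sum_{t^n}p(t^n)\Pr\{t^n\ne\phi_2(Y_2^n)\mid T^n=t^n\}$. Admissibility: $(S,T)$ is admissible for the channel if for every $\epsilon\in(0,1)$ and all sufficiently large $n$ there exists a length-$n$ block code $(f_1,f_2,\phi_1,\phi_2)$ with $\max\{P_{e1},P_{e2}\}\le\epsilon$. *)

theory Defs
  imports "HOL-Probability.Probability"
begin

section \<open>Random variables with finite alphabets\<close>

text \<open>
  The alphabets are types of class \<open>finite\<close>; random variables are functions on the sample
  space of a pmf. Entropies are in bits, and are the quantities of \<^theory>\<open>HOL-Probability.Information\<close>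
  (those behind its notation for simple random variables) for the space \<open>measure_pmf P\<close>.
\<close>

abbreviation (input) rv_pair :: "('o \<Rightarrow> 'a) \<Rightarrow> ('o \<Rightarrow> 'b) \<Rightarrow> 'o \<Rightarrow> 'a \<times> 'b" (infixr \<open>\<triangle>\<close> 75) where
  "X \<triangle> Y \<equiv> (\<lambda>\<omega>. (X \<omega>, Y \<omega>))"

definition entropy_bits :: "'o pmf \<Rightarrow> ('o \<Rightarrow> 'a::finite) \<Rightarrow> real" where
  "entropy_bits P X = prob_space.entropy (measure_pmf P) 2 (count_space (range X)) X"

definition mutual_info :: "'o pmf \<Rightarrow> ('o \<Rightarrow> 'a::finite) \<Rightarrow> ('o \<Rightarrow> 'b::finite) \<Rightarrow> real" where
  "mutual_info P X Y =
     prob_space.mutual_information (measure_pmf P) 2 (count_space (range X)) (count_space (range Y)) X Y"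

definition cond_mutual_info ::
    "'o pmf \<Rightarrow> ('o \<Rightarrow> 'a::finite) \<Rightarrow> ('o \<Rightarrow> 'b::finite) \<Rightarrow> ('o \<Rightarrow> 'c::finite) \<Rightarrow> real" where
  "cond_mutual_info P X Y Z =
     prob_space.conditional_mutual_information (measure_pmf P) 2
       (count_space (range X)) (count_space (range Y)) (count_space (range Z)) X Y Z"

lemma information_space_measure_pmf: "information_space (measure_pmf P) 2"
  by (simp add: information_space_def information_space_axioms_def measure_pmf.prob_space_axioms)

lemma simple_distributed_pmf:
  fixes X :: "'o \<Rightarrow> 'a::finite"
  shows "simple_distributed (measure_pmf P) X (pmf (map_pmf X P))"
  by (rule measure_pmf.simple_distributedI) (auto simp: simple_function_def pmf_map)

lemma entropy_bits_eq:
  "entropy_bits P X = - (\<Sum>x\<in>range X. pmf (map_pmf X P) x * log 2 (pmf (map_pmf X P) x))"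
  unfolding entropy_bits_def
  using information_space.entropy_simple_distributed[OF information_space_measure_pmf
      simple_distributed_pmf[of P X]] by simp

lemma mutual_info_eq:
  "mutual_info P X Y =
     (\<Sum>(x, y)\<in>range (X \<triangle> Y). pmf (map_pmf (X \<triangle> Y) P) (x, y) *
        log 2 (pmf (map_pmf (X \<triangle> Y) P) (x, y) / (pmf (map_pmf X P) x * pmf (map_pmf Y P) y)))"
  unfolding mutual_info_def
  using information_space.mutual_information_simple_distributed[OF information_space_measure_pmf
      simple_distributed_pmf[of P X] simple_distributed_pmf[of P Y]
      simple_distributed_pmf[of P "X \<triangle> Y"]] by simp

lemma cond_mutual_info_eq:
  "cond_mutual_info P X Y Z =
     (\<Sum>(x, y, z)\<in>range (X \<triangle> Y \<triangle> Z). pmf (map_pmf (X \<triangle> Y \<triangle> Z) P) (x, y, z) *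
        log 2 (pmf (map_pmf (X \<triangle> Y \<triangle> Z) P) (x, y, z) /
          (pmf (map_pmf (X \<triangle> Z) P) (x, z) *
            (pmf (map_pmf (Y \<triangle> Z) P) (y, z) / pmf (map_pmf Z P) z))))"
  unfolding cond_mutual_info_def
  using information_space.conditional_mutual_information_eq[OF information_space_measure_pmf
      simple_distributed_pmf[of P Z] simple_distributed_pmf[of P "Y \<triangle> Z"]
      simple_distributed_pmf[of P "X \<triangle> Z"] simple_distributed_pmf[of P "X \<triangle> Y \<triangle> Z"]] by simp


section \<open>Block codes for the interference channel\<close>

text \<open>Blocks of length \<open>n\<close> are lists.\<close>

definition blocks :: "nat \<Rightarrow> 'a list set" where
  "blocks n = {xs. length xs = n}"

text \<open>Only input blocks of equal length are relevant.\<close>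

fun block_channel ::
    "('x1 \<Rightarrow> 'x2 \<Rightarrow> ('y1 \<times> 'y2) pmf) \<Rightarrow> 'x1 list \<Rightarrow> 'x2 list \<Rightarrow> ('y1 \<times> 'y2) list pmf" where
  "block_channel ch (x1 # xs1) (x2 # xs2) =
     do {y \<leftarrow> ch x1 x2; ys \<leftarrow> block_channel ch xs1 xs2; return_pmf (y # ys)}"
| "block_channel ch _ _ = return_pmf []"

lemma pmf_bind_Cons:
  "pmf (do {x \<leftarrow> p; xs \<leftarrow> q; return_pmf (x # xs)}) (y # ys) = pmf p y * pmf q ys"
proof -
  have "do {x \<leftarrow> p; xs \<leftarrow> q; return_pmf (x # xs)} = map_pmf (\<lambda>(x, xs). x # xs) (pair_pmf p q)"
    by (simp add: pair_pmf_def map_pmf_def bind_assoc_pmf bind_return_pmf)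
  moreover have "inj (\<lambda>(x, xs). x # xs)"
    by (auto intro!: injI)
  ultimately show ?thesis
    using pmf_map_inj'[of "\<lambda>(x, xs). x # xs" "pair_pmf p q" "(y, ys)"] by (simp add: pmf_pair)
qed

text \<open>The source and the channel are memoryless.\<close>

lemma pmf_replicate_pmf:
  "length xs = n \<Longrightarrow> pmf (replicate_pmf n p) xs = (\<Prod>i<n. pmf p (xs ! i))"
  by (induction xs arbitrary: n) (auto simp: pmf_bind_Cons prod.lessThan_Suc_shift simp del: prod.lessThan_Suc)

lemma pmf_block_channel:
  assumes "length xs1 = n" "length xs2 = n" "length ys = n"
  shows "pmf (block_channel ch xs1 xs2) ys = (\<Prod>i<n. pmf (ch (xs1 ! i) (xs2 ! i)) (ys ! i))"
  using assms
proof (induction n arbitrary: xs1 xs2 ys)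
  case (Suc n)
  then show ?case
    by (auto simp: length_Suc_conv pmf_bind_Cons prod.lessThan_Suc_shift simp del: prod.lessThan_Suc)
qed auto

text \<open>The joint law of \<open>(S\<^sup>n, T\<^sup>n, Y\<^sub>1\<^sup>n, Y\<^sub>2\<^sup>n)\<close>.\<close>

definition code_law ::
    "('s \<times> 't) pmf \<Rightarrow> ('x1 \<Rightarrow> 'x2 \<Rightarrow> ('y1 \<times> 'y2) pmf) \<Rightarrow> nat \<Rightarrow>
     ('s list \<Rightarrow> 'x1 list) \<Rightarrow> ('t list \<Rightarrow> 'x2 list) \<Rightarrow> ('s list \<times> 't list \<times> 'y1 list \<times> 'y2 list) pmf" where
  "code_law p ch n f1 f2 =
     do {st \<leftarrow> replicate_pmf n p;
         y \<leftarrow> block_channel ch (f1 (map fst st)) (f2 (map snd st));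
         return_pmf (map fst st, map snd st, map fst y, map snd y)}"

definition error_prob1 ::
    "('s::finite \<times> 't::finite) pmf \<Rightarrow> ('x1 \<Rightarrow> 'x2 \<Rightarrow> ('y1 \<times> 'y2) pmf) \<Rightarrow> nat \<Rightarrow>
     ('s list \<Rightarrow> 'x1 list) \<Rightarrow> ('t list \<Rightarrow> 'x2 list) \<Rightarrow> ('y1 list \<Rightarrow> 's list) \<Rightarrow> real" where
  "error_prob1 p ch n f1 f2 \<phi>1 =
     (\<Sum>s\<in>blocks n. pmf (replicate_pmf n (map_pmf fst p)) s *
        \<P>((sn, tn, y1, y2) in code_law p ch n f1 f2. s \<noteq> \<phi>1 y1 \<bar> sn = s))"

definition error_prob2 ::
    "('s::finite \<times> 't::finite) pmf \<Rightarrow> ('x1 \<Rightarrow> 'x2 \<Rightarrow> ('y1 \<times> 'y2) pmf) \<Rightarrow> nat \<Rightarrow>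
     ('s list \<Rightarrow> 'x1 list) \<Rightarrow> ('t list \<Rightarrow> 'x2 list) \<Rightarrow> ('y2 list \<Rightarrow> 't list) \<Rightarrow> real" where
  "error_prob2 p ch n f1 f2 \<phi>2 =
     (\<Sum>t\<in>blocks n. pmf (replicate_pmf n (map_pmf snd p)) t *
        \<P>((sn, tn, y1, y2) in code_law p ch n f1 f2. t \<noteq> \<phi>2 y2 \<bar> tn = t))"

definition admissible ::
    "('s::finite \<times> 't::finite) pmf \<Rightarrow>
     ('x1::finite \<Rightarrow> 'x2::finite \<Rightarrow> ('y1::finite \<times> 'y2::finite) pmf) \<Rightarrow> bool" where
  "admissible p ch \<longleftrightarrow>
     (\<forall>\<epsilon>\<in>{0<..<1}. \<forall>\<^sub>F n in sequentially.
        \<exists>f1 f2 \<phi>1 \<phi>2.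
          f1 \<in> blocks n \<rightarrow> blocks n \<and> f2 \<in> blocks n \<rightarrow> blocks n \<and>
          \<phi>1 \<in> blocks n \<rightarrow> blocks n \<and> \<phi>2 \<in> blocks n \<rightarrow> blocks n \<and>
          max (error_prob1 p ch n f1 f2 \<phi>1) (error_prob2 p ch n f1 f2 \<phi>2) \<le> \<epsilon>)"

end

(*
Superposition coding with random binning. Each block of K gets a random codeword W0. On top of
it user 1 draws about 2^(n u) cloud centres W1, puts every block of S' into a random bin and draws for
it a satellite X1 of the centre of its bin; user 2 does the same with 2^(n v) centres W2. Receiver 1
looks for the pair (K, S') that fits Y1 together with some bin of user 2. For each of the five kinds of
wrong candidate, "fits" means that the likelihood ratio of the law of the true tuple to the law of such
a candidate is large, so a candidate passes with probability 2^(-n D), D close to the divergence of the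
two laws. This gives, with R1 = H(S') and R0 = H(K),

  R1 - u < D,  R1 + v - u < D,  R1 < D,  R1 + v < D,  R0 + R1 + v < D

with the divergence D of the respective kind (they dominate the informations in the theorem), and
symmetrically for receiver 2. Fourier-Motzkin elimination of u and v leaves exactly the inequalities of
the theorem. It is essential here that u may exceed R1: with the usual rate splitting u <= R1 two more
inequalities would remain.
*)

theory Submission
  imports Defs
begin

section \<open>Random codebooks\<close>

text \<open>The sources are not uniform, so a receiver searches only typical blocks, about 2^(nR) of
  them, and an atypical source block is charged as an error of its own. Binning does the work of
  rate splitting: two messages of user 1 share a bin with probability about 2^(-nu), and only then
  can a wrong message have the right centre; this is the origin of the terms \<open>- u\<close>. A
  wrong bin of user 2 together with the right pair is no error, so it yields no inequality. In the
  notation of \<open>fourier_motzkin\<close>, imposing \<open>v <= R2\<close> would turn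
  \<open>R2 + u - v < e2\<close> into \<open>u < e2\<close>; with \<open>R1 - u < a1\<close> this
  forces \<open>R1 < a1 + e2\<close>, which is not among the hypotheses. Likelihood ratios take the
  place of joint typicality, because a change of measure then bounds all kinds of wrong candidates
  in the same way. The decoding bound is proved for a single use over arbitrary alphabets and
  applied with whole blocks as letters; memorylessness enters only when the resulting laws are
  recognised as product laws.\<close>

lemma nn_integral_Pi_pmf_component:
  assumes "finite A" "x \<in> A"
  shows "(\<integral>\<^sup>+f. \<phi> (f x) \<partial>Pi_pmf A d p) = (\<integral>\<^sup>+a. \<phi> a \<partial>p x)"
proof -
  have "(\<integral>\<^sup>+f. \<phi> (f x) \<partial>Pi_pmf A d p) = (\<integral>\<^sup>+a. \<phi> a \<partial>map_pmf (\<lambda>f. f x) (Pi_pmf A d p))"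
    by simp
  then show ?thesis using assms by (simp add: Pi_pmf_component del: nn_integral_map_pmf)
qed

lemma nn_integral_Pi_pmf_component2:
  assumes "finite A" "x \<in> A" "y \<in> A" "x \<noteq> y"
  shows "(\<integral>\<^sup>+f. \<phi> (f x) (f y) \<partial>Pi_pmf A d p) = (\<integral>\<^sup>+a. \<integral>\<^sup>+b. \<phi> a b \<partial>p y \<partial>p x)"
proof -
  have "Pi_pmf A d p = do {a \<leftarrow> p x; f \<leftarrow> Pi_pmf (A - {x}) d p; return_pmf (f(x := a))}"
    using assms Pi_pmf_insert'[of "A - {x}" x d p] by (simp add: insert_absorb)
  then show ?thesis
    using assms by (simp add: nn_integral_Pi_pmf_component[of "A - {x}" y])
qed

text \<open>The codebook of one user for a fixed codeword of \<open>K\<close>: \<open>N\<close> cloud centres and, for every message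
  in \<open>A\<close>, a uniform bin index together with a satellite of the centre of that bin. The number of
  bins may exceed the number of messages.\<close>

definition user_book :: "nat \<Rightarrow> 's set \<Rightarrow> 'w pmf \<Rightarrow> ('w \<Rightarrow> 'x pmf) \<Rightarrow> ((nat \<Rightarrow> 'w) \<times> ('s \<Rightarrow> nat \<times> 'x)) pmf" where
  "user_book N A p q = do {
     w \<leftarrow> Pi_pmf {..<N} undefined (\<lambda>_. p);
     hx \<leftarrow> Pi_pmf A undefined (\<lambda>_. do {i \<leftarrow> pmf_of_set {..<N}; x \<leftarrow> q (w i); return_pmf (i, x)});
     return_pmf (w, hx)}"

definition bin :: "(nat \<Rightarrow> 'w) \<times> ('s \<Rightarrow> nat \<times> 'x) \<Rightarrow> 's \<Rightarrow> nat" where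
  "bin b s = fst (snd b s)"
definition cloud :: "(nat \<Rightarrow> 'w) \<times> ('s \<Rightarrow> nat \<times> 'x) \<Rightarrow> nat \<Rightarrow> 'w" where
  "cloud b i = fst b i"
definition satellite :: "(nat \<Rightarrow> 'w) \<times> ('s \<Rightarrow> nat \<times> 'x) \<Rightarrow> 's \<Rightarrow> 'x" where
  "satellite b s = snd (snd b s)"

lemma nn_integral_pmf_of_set_lessThan:
  "N > 0 \<Longrightarrow> (\<integral>\<^sup>+i. f i \<partial>pmf_of_set {..<N::nat}) = (\<Sum>i<N. f i) / of_nat N"
  by (subst nn_integral_pmf_of_set) (auto simp: lessThan_empty_iff)

lemma of_nat_mult_divide_of_nat: "(N::nat) > 0 \<Longrightarrow> of_nat N * (c::ennreal) / of_nat N = c"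
  by (metis ennreal_mult_divide_eq mult.commute of_nat_less_top bot_nat_0.not_eq_extremum of_nat_eq_0_iff less_irrefl infinity_ennreal_def)

text \<open>Tonelli, read off from \<open>bind_commute_pmf\<close>. Going through
  \<open>bind_pmf\<close> keeps product sigma-algebras out of the argument, although codebooks may
  range over uncountable function types.\<close>

lemma nn_integral_pmf_commute:
  "(\<integral>\<^sup>+x. \<integral>\<^sup>+y. f x y \<partial>measure_pmf q \<partial>measure_pmf p) = (\<integral>\<^sup>+y. \<integral>\<^sup>+x. f x y \<partial>measure_pmf p \<partial>measure_pmf q)"
proof -
  have "(\<integral>\<^sup>+x. \<integral>\<^sup>+y. f x y \<partial>q \<partial>p)
    = nn_integral (bind_pmf p (\<lambda>x. bind_pmf q (\<lambda>y. return_pmf (x, y)))) (case_prod f)"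
    by simp
  also have "\<dots> = nn_integral (bind_pmf q (\<lambda>y. bind_pmf p (\<lambda>x. return_pmf (x, y)))) (case_prod f)"
    by (subst bind_commute_pmf) (rule refl)
  finally show ?thesis by simp
qed

lemma nn_integral_user_book:
  assumes "finite A" "s \<in> A" "N > 0"
  shows "(\<integral>\<^sup>+b. \<phi> (fst b) (bin b s) (satellite b s) \<partial>user_book N A p q)
    = (\<integral>\<^sup>+w. (\<Sum>i<N. \<integral>\<^sup>+x. \<phi> w i x \<partial>q (w i)) / of_nat N \<partial>Pi_pmf {..<N} undefined (\<lambda>_. p))"
proof -
  have "(\<integral>\<^sup>+hx. \<phi> w (fst (hx s)) (snd (hx s)) \<partial>Pi_pmf A undefined
       (\<lambda>_. bind_pmf (pmf_of_set {..<N}) (\<lambda>i. bind_pmf (q (w i)) (\<lambda>x. return_pmf (i, x)))))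
    = (\<Sum>i<N. \<integral>\<^sup>+x. \<phi> w i x \<partial>q (w i)) / of_nat N" for w
    using assms by (subst nn_integral_Pi_pmf_component[where \<phi> = "\<lambda>z. \<phi> w (fst z) (snd z)"])
      (simp_all add: nn_integral_pmf_of_set_lessThan)
  then show ?thesis
    by (simp add: user_book_def bin_def satellite_def)
qed

lemma nn_integral_user_book2:
  assumes "finite A" "s \<in> A" "s' \<in> A" "s \<noteq> s'" "N > 0"
  shows "(\<integral>\<^sup>+b. \<phi> (fst b) (bin b s) (satellite b s) (bin b s') (satellite b s') \<partial>user_book N A p q)
    = (\<integral>\<^sup>+w. (\<Sum>i<N. (\<integral>\<^sup>+x. (\<Sum>j<N. \<integral>\<^sup>+x'. \<phi> w i x j x' \<partial>q (w j)) / of_nat N \<partial>q (w i))) / of_nat N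
        \<partial>Pi_pmf {..<N} undefined (\<lambda>_. p))"
proof -
  have "(\<integral>\<^sup>+hx. \<phi> w (fst (hx s)) (snd (hx s)) (fst (hx s')) (snd (hx s')) \<partial>Pi_pmf A undefined
       (\<lambda>_. bind_pmf (pmf_of_set {..<N}) (\<lambda>i. bind_pmf (q (w i)) (\<lambda>x. return_pmf (i, x)))))
    = (\<Sum>i<N. (\<integral>\<^sup>+x. (\<Sum>j<N. \<integral>\<^sup>+x'. \<phi> w i x j x' \<partial>q (w j)) / of_nat N \<partial>q (w i))) / of_nat N" for w
    using assms
    by (subst nn_integral_Pi_pmf_component2[where \<phi> = "\<lambda>z z'. \<phi> w (fst z) (snd z) (fst z') (snd z')"])
      (simp_all add: nn_integral_pmf_of_set_lessThan)
  then show ?thesis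
    by (simp add: user_book_def bin_def satellite_def)
qed

text \<open>The bin index of \<open>s\<close> is drawn independently of the centres, so the centre
  found through it has the law of a single centre.\<close>

lemma user_book_single:
  assumes "finite A" "s \<in> A" "N > 0"
  shows "(\<integral>\<^sup>+b. \<phi> (cloud b (bin b s)) (satellite b s) \<partial>user_book N A p q)
    = (\<integral>\<^sup>+w. \<integral>\<^sup>+x. \<phi> w x \<partial>q w \<partial>p)"
proof -
  have "(\<integral>\<^sup>+b. \<phi> (cloud b (bin b s)) (satellite b s) \<partial>user_book N A p q)
     = (\<integral>\<^sup>+w. (\<Sum>i<N. \<integral>\<^sup>+x. \<phi> (w i) x \<partial>q (w i)) / of_nat N \<partial>Pi_pmf {..<N} undefined (\<lambda>_. p))"
    using assms
    unfolding cloud_def by (subst nn_integral_user_book[where \<phi> = "\<lambda>w i x. \<phi> (w i) x"]) auto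
  also have "\<dots> = (\<Sum>i<N. \<integral>\<^sup>+w. (\<integral>\<^sup>+x. \<phi> (w i) x \<partial>q (w i)) \<partial>Pi_pmf {..<N} undefined (\<lambda>_. p)) / of_nat N"
    by (simp add: nn_integral_divide nn_integral_sum)
  also have "\<dots> = (\<Sum>i<N. \<integral>\<^sup>+w. (\<integral>\<^sup>+x. \<phi> w x \<partial>q w) \<partial>p) / of_nat N"
    by (intro arg_cong[where f = "\<lambda>c. c / of_nat N"] sum.cong refl
      nn_integral_Pi_pmf_component[where \<phi> = "\<lambda>w. \<integral>\<^sup>+x. \<phi> w x \<partial>q w"]) auto
  also have "\<dots> = (\<integral>\<^sup>+w. (\<integral>\<^sup>+x. \<phi> w x \<partial>q w) \<partial>p)"
    using assms by (simp add: of_nat_mult_divide_of_nat)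
  finally show ?thesis .
qed

text \<open>Two independent uniform indices coincide with probability \<open>1 / N\<close>; the
  weight of the opposite case is bounded by 1.\<close>

lemma sum_diagonal_plus_rest_le:
  fixes a b :: ennreal
  assumes "\<And>i. i < N \<Longrightarrow> F i i = a" "\<And>i j. i < N \<Longrightarrow> j < N \<Longrightarrow> i \<noteq> j \<Longrightarrow> F i j = b" "N > 0"
  shows "(\<Sum>i<N. (\<Sum>j<N. F i j) / of_nat N) / of_nat N \<le> a / of_nat N + b"
proof -
  have *: "(\<Sum>j<N. F i j) \<le> a + of_nat N * b" if "i < N" for i
  proof -
    have "(\<Sum>j<N. F i j) = a + (\<Sum>j\<in>{..<N}-{i}. F i j)"
      using that assms by (subst sum.remove[of _ i]) auto
    also have "(\<Sum>j\<in>{..<N}-{i}. F i j) = (\<Sum>j\<in>{..<N}-{i}. b)"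
      using that assms by (intro sum.cong) auto
    also have "\<dots> \<le> (\<Sum>j<N. b)" by (intro sum_mono2) auto
    finally show ?thesis by simp
  qed
  have "(\<Sum>i<N. (\<Sum>j<N. F i j) / of_nat N) / of_nat N \<le> (\<Sum>i<N. (a + of_nat N * b) / of_nat N) / of_nat N"
    by (intro divide_right_mono_ennreal sum_mono *) simp
  also have "\<dots> = (a + of_nat N * b) / of_nat N"
    using assms by (simp add: of_nat_mult_divide_of_nat)
  also have "\<dots> = a / of_nat N + b"
    using assms by (simp add: add_divide_distrib_ennreal ennreal_mult_divide_eq mult.commute)
  finally show ?thesis .
qed

text \<open>Two messages share a bin with probability \<open>1 / N\<close>, and then their
  satellites are independent given a common centre; in different bins even the centres are
  independent.\<close>

lemma user_book_pair_le:
  assumes "finite A" "s \<in> A" "s' \<in> A" "s \<noteq> s'" "N > 0"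
  shows "(\<integral>\<^sup>+b. \<phi> (cloud b (bin b s)) (satellite b s) (cloud b (bin b s')) (satellite b s') \<partial>user_book N A p q)
    \<le> (\<integral>\<^sup>+w. \<integral>\<^sup>+x. \<integral>\<^sup>+x'. \<phi> w x w x' \<partial>q w \<partial>q w \<partial>p) / of_nat N
      + (\<integral>\<^sup>+w. \<integral>\<^sup>+x. \<integral>\<^sup>+w'. \<integral>\<^sup>+x'. \<phi> w x w' x' \<partial>q w' \<partial>p \<partial>q w \<partial>p)" (is "?L \<le> ?R")
proof -
  define G where "G w w' = (\<integral>\<^sup>+x. \<integral>\<^sup>+x'. \<phi> w x w' x' \<partial>q w' \<partial>q w)" for w w'
  let ?P = "Pi_pmf {..<N} undefined (\<lambda>_. p)"
  have "?L = (\<integral>\<^sup>+w. (\<Sum>i<N. (\<integral>\<^sup>+x. (\<Sum>j<N. \<integral>\<^sup>+x'. \<phi> (w i) x (w j) x' \<partial>q (w j)) / of_nat N \<partial>q (w i))) / of_nat N \<partial>?P)"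
    using assms
    unfolding cloud_def
    by (subst nn_integral_user_book2[where \<phi> = "\<lambda>w i x j x'. \<phi> (w i) x (w j) x'"]) auto
  also have "\<dots> = (\<Sum>i<N. (\<Sum>j<N. \<integral>\<^sup>+w. G (w i) (w j) \<partial>?P) / of_nat N) / of_nat N"
    by (simp add: nn_integral_divide nn_integral_sum G_def)
  also have "\<dots> \<le> (\<integral>\<^sup>+w. G w w \<partial>p) / of_nat N + (\<integral>\<^sup>+w. \<integral>\<^sup>+w'. G w w' \<partial>p \<partial>p)"
    using assms
    by (intro sum_diagonal_plus_rest_le nn_integral_Pi_pmf_component[where \<phi> = "\<lambda>w. G w w"]
      nn_integral_Pi_pmf_component2) auto
  also have "\<dots> = ?R"
    by (simp add: G_def nn_integral_pmf_commute[where q = p and p = "q _"])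
  finally show ?thesis .
qed

text \<open>Exactly one of the \<open>N\<close> centres belongs to the bin of \<open>s\<close>, and
  the other \<open>N - 1\<close> are independent of it. This is the price of trying all bins of the
  other user.\<close>

lemma user_book_cloud_le:
  assumes "finite A" "s \<in> A" "N > 0"
  shows "(\<Sum>j<N. \<integral>\<^sup>+b. \<phi> (cloud b (bin b s)) (satellite b s) (cloud b j) \<partial>user_book N A p q)
    \<le> (\<integral>\<^sup>+w. \<integral>\<^sup>+x. \<phi> w x w \<partial>q w \<partial>p)
      + of_nat N * (\<integral>\<^sup>+w. \<integral>\<^sup>+x. \<integral>\<^sup>+w'. \<phi> w x w' \<partial>p \<partial>q w \<partial>p)" (is "?L \<le> ?R")
proof -
  define G where "G w w' = (\<integral>\<^sup>+x. \<phi> w x w' \<partial>q w)" for w w'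
  let ?P = "Pi_pmf {..<N} undefined (\<lambda>_. p)"
  have "?L = (\<Sum>j<N. \<integral>\<^sup>+w. (\<Sum>i<N. G (w i) (w j)) / of_nat N \<partial>?P)"
    using assms unfolding cloud_def G_def
    by (subst nn_integral_user_book[where \<phi> = "\<lambda>w i x. \<phi> (w i) x (w j)" for j]) auto
  \<comment> \<open>Writing the sum over \<open>j\<close> as \<open>N\<close> times an average
    produces the double average of \<open>sum_diagonal_plus_rest_le\<close>, whose diagonal term
    then loses its factor \<open>1 / N\<close>.\<close>
  also have "\<dots> = of_nat N * ((\<Sum>j<N. (\<Sum>i<N. \<integral>\<^sup>+w. G (w i) (w j) \<partial>?P) / of_nat N) / of_nat N)"
    using assms by (simp add: nn_integral_divide nn_integral_sum ennreal_times_divide of_nat_mult_divide_of_nat)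
  also have "\<dots> \<le> of_nat N * ((\<integral>\<^sup>+w. G w w \<partial>p) / of_nat N + (\<integral>\<^sup>+w. \<integral>\<^sup>+w'. G w w' \<partial>p \<partial>p))"
    using assms
    by (intro mult_left_mono sum_diagonal_plus_rest_le nn_integral_Pi_pmf_component[where \<phi> = "\<lambda>w. G w w"]
      nn_integral_Pi_pmf_component2) auto
  also have "\<dots> = ?R"
    using assms by (simp add: G_def nn_integral_pmf_commute[where q = p and p = "q _"] distrib_left ennreal_times_divide of_nat_mult_divide_of_nat)
  finally show ?thesis .
qed

section \<open>Memoryless kernels on blocks\<close>

fun block_kernel :: "('a \<Rightarrow> 'b pmf) \<Rightarrow> 'a list \<Rightarrow> 'b list pmf" where
  "block_kernel f [] = return_pmf []"
| "block_kernel f (x # xs) = do {y \<leftarrow> f x; ys \<leftarrow> block_kernel f xs; return_pmf (y # ys)}"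

lemma block_kernel_map: "block_kernel f (map g xs) = block_kernel (\<lambda>x. f (g x)) xs"
  by (induction xs) auto

lemma block_kernel_const: "block_kernel (\<lambda>_. p) xs = replicate_pmf (length xs) p"
  by (induction xs) auto

lemma map_block_kernel: "map_pmf (map g) (block_kernel f xs) = block_kernel (\<lambda>x. map_pmf g (f x)) xs"
proof (induction xs)
  case (Cons x xs)
  have "map_pmf (map g) (block_kernel f (x # xs))
    = bind_pmf (f x) (\<lambda>y. bind_pmf (map_pmf (map g) (block_kernel f xs)) (\<lambda>ys. return_pmf (g y # ys)))"
    by (simp add: map_bind_pmf bind_map_pmf)
  then show ?case by (simp add: Cons bind_map_pmf)
qed simp

lemma set_block_kernel_length: "ys \<in> set_pmf (block_kernel f xs) \<Longrightarrow> length ys = length xs"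
  by (induction xs arbitrary: ys) auto

lemma block_channel_eq_block_kernel: "block_channel ch xs ys = block_kernel (\<lambda>(a, b). ch a b) (zip xs ys)"
proof (induction xs arbitrary: ys)
  case (Cons x xs)
  then show ?case by (cases ys) auto
qed simp

text \<open>The continuation \<open>G\<close> is arbitrary so that, as a rewrite rule, this fuses a
  whole chain of block draws, one kernel at a time, into one i.i.d. draw of tuples.\<close>

lemma replicate_bind_block_kernel:
  "bind_pmf (replicate_pmf n p) (\<lambda>xs. bind_pmf (block_kernel f xs) (\<lambda>ys. G xs ys)) =
   bind_pmf (replicate_pmf n (bind_pmf p (\<lambda>x. bind_pmf (f x) (\<lambda>y. return_pmf (x, y)))))
     (\<lambda>zs. G (map fst zs) (map snd zs))"
proof (induction n arbitrary: G)
  case (Suc n)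
  have "bind_pmf (replicate_pmf (Suc n) p) (\<lambda>xs. bind_pmf (block_kernel f xs) (\<lambda>ys. G xs ys))
    = do {x \<leftarrow> p; xs \<leftarrow> replicate_pmf n p; y \<leftarrow> f x; ys \<leftarrow> block_kernel f xs; G (x # xs) (y # ys)}"
    by (simp add: bind_assoc_pmf bind_return_pmf)
  \<comment> \<open>The letter \<open>y\<close> depends on \<open>x\<close> alone, so it may be
    drawn before the remaining letters \<open>xs\<close>.\<close>
  also have "\<dots> = do {x \<leftarrow> p; y \<leftarrow> f x; xs \<leftarrow> replicate_pmf n p; ys \<leftarrow> block_kernel f xs; G (x # xs) (y # ys)}"
    by (subst bind_commute_pmf) (rule refl)
  also have "\<dots> = do {x \<leftarrow> p; y \<leftarrow> f x; zs \<leftarrow> replicate_pmf n (bind_pmf p (\<lambda>x. bind_pmf (f x) (\<lambda>y. return_pmf (x, y))));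
      G (x # map fst zs) (y # map snd zs)}"
    by (subst Suc) (rule refl)
  finally show ?case
    by (simp add: bind_assoc_pmf bind_return_pmf)
qed (simp add: bind_return_pmf)

lemma replicate_bind_replicate:
  "bind_pmf (replicate_pmf n p) (\<lambda>xs. bind_pmf (replicate_pmf n q) (\<lambda>ys. G xs ys)) =
   bind_pmf (replicate_pmf n (bind_pmf p (\<lambda>x. bind_pmf q (\<lambda>y. return_pmf (x, y)))))
     (\<lambda>zs. G (map fst zs) (map snd zs))"
proof -
  have "bind_pmf (replicate_pmf n p) (\<lambda>xs. bind_pmf (replicate_pmf n q) (\<lambda>ys. G xs ys))
    = bind_pmf (replicate_pmf n p) (\<lambda>xs. bind_pmf (block_kernel (\<lambda>_. q) xs) (\<lambda>ys. G xs ys))"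
    by (intro bind_pmf_cong) (auto simp: block_kernel_const set_replicate_pmf)
  then show ?thesis by (simp add: replicate_bind_block_kernel)
qed

section \<open>Laws of the right candidate and of wrong candidates\<close>

text \<open>\<open>x2\<close> is drawn for the sake of the channel and then forgotten: the receiver
  tests the centre of the other user, never its satellite.\<close>

definition true_law where
  "true_law p0 p1 q1 p2 q2 ch = do {
     w0 \<leftarrow> p0; w1 \<leftarrow> p1 w0; x1 \<leftarrow> q1 w0 w1; w2 \<leftarrow> p2 w0; x2 \<leftarrow> q2 w0 w2;
     y \<leftarrow> ch x1 x2; return_pmf (w0, w1, x1, w2, y)}"

text \<open>The laws of a wrong candidate at a receiver that has the right codeword of \<open>K\<close>: \<open>b1\<close> says that
  the wrong message lies in the bin of the right one, \<open>b2\<close> that the other user's bin is right.\<close>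

definition mixed_law where
  "mixed_law b1 b2 p0 p1 q1 p2 q2 ch = do {
     w0 \<leftarrow> p0; w1 \<leftarrow> p1 w0; x1 \<leftarrow> q1 w0 w1;
     w1' \<leftarrow> (if b1 then return_pmf w1 else p1 w0); x1' \<leftarrow> q1 w0 w1';
     w2 \<leftarrow> p2 w0; x2 \<leftarrow> q2 w0 w2; w2' \<leftarrow> (if b2 then return_pmf w2 else p2 w0);
     y \<leftarrow> ch x1 x2; return_pmf (w0, w1', x1', w2', y)}"

text \<open>A wrong block of \<open>K\<close> has an independent book, so the candidate is
  independent of the output; its own parts still share the new \<open>w0'\<close>.\<close>

definition fresh_law where
  "fresh_law p0 p1 q1 p2 q2 ch = do {
     w0 \<leftarrow> p0; w1 \<leftarrow> p1 w0; x1 \<leftarrow> q1 w0 w1; w2 \<leftarrow> p2 w0; x2 \<leftarrow> q2 w0 w2; y \<leftarrow> ch x1 x2;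
     w0' \<leftarrow> p0; w1' \<leftarrow> p1 w0'; x1' \<leftarrow> q1 w0' w1'; w2' \<leftarrow> p2 w0'; return_pmf (w0', w1', x1', w2', y)}"

abbreviation block_kernel2 where "block_kernel2 f xs ys \<equiv> block_kernel (\<lambda>(x, y). f x y) (zip xs ys)"

text \<open>Passes from blocks of tuples to tuples of blocks. Since it is injective, point masses
  and hence likelihood ratios survive the regrouping unchanged.\<close>

definition unzip5 :: "('a \<times> 'b \<times> 'c \<times> 'd \<times> 'e) list \<Rightarrow> 'a list \<times> 'b list \<times> 'c list \<times> 'd list \<times> 'e list" where
  "unzip5 zs = (map fst zs, map (fst \<circ> snd) zs, map (fst \<circ> snd \<circ> snd) zs,
     map (fst \<circ> snd \<circ> snd \<circ> snd) zs, map (snd \<circ> snd \<circ> snd \<circ> snd) zs)"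

lemma inj_unzip5: "inj unzip5"
proof (rule injI)
  fix xs ys :: "('a \<times> 'b \<times> 'c \<times> 'd \<times> 'e) list"
  assume eq: "unzip5 xs = unzip5 ys"
  then have "length xs = length ys" by (auto simp: unzip5_def dest: map_eq_imp_length_eq)
  then show "xs = ys" using eq
    by (induction xs ys rule: list_induct2) (auto simp: unzip5_def prod_eq_iff)
qed

lemma zip_maps: "zip (map f zs) (map g zs) = map (\<lambda>z. (f z, g z)) zs"
  by (induction zs) auto

lemma replicate_pmf_map: "replicate_pmf n (map_pmf f p) = map_pmf (map f) (replicate_pmf n p)"
  by (induction n) (simp_all add: map_bind_pmf bind_map_pmf)

lemma collect_unzip5:
  "bind_pmf (replicate_pmf n J) (\<lambda>zs. return_pmf (map f1 zs, map f2 zs, map f3 zs, map f4 zs, map f5 zs))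
    = map_pmf unzip5 (replicate_pmf n (map_pmf (\<lambda>z. (f1 z, f2 z, f3 z, f4 z, f5 z)) J))"
  by (simp add: replicate_pmf_map map_pmf_comp unzip5_def o_def flip: map_pmf_def)

text \<open>The decoding bound treats blocks as single letters. This identity and its two companions
  show that the laws occurring in it are, up to regrouping, i.i.d. products of the one-letter
  laws.\<close>

lemma true_law_block:
  "true_law (replicate_pmf n p0) (block_kernel p1) (block_kernel2 q1) (block_kernel p2) (block_kernel2 q2) (block_kernel2 ch) =
   map_pmf unzip5 (replicate_pmf n (true_law p0 p1 q1 p2 q2 ch))"
  unfolding true_law_def
  by (simp add: replicate_bind_block_kernel block_kernel_map zip_maps collect_unzip5)
   (simp add: map_bind_pmf bind_assoc_pmf bind_return_pmf)

lemma mixed_law_block: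
  "mixed_law b1 b2 (replicate_pmf n p0) (block_kernel p1) (block_kernel2 q1) (block_kernel p2) (block_kernel2 q2) (block_kernel2 ch) =
   map_pmf unzip5 (replicate_pmf n (mixed_law b1 b2 p0 p1 q1 p2 q2 ch))"
  unfolding mixed_law_def
  by (cases b1; cases b2; simp add: replicate_bind_block_kernel block_kernel_map zip_maps bind_return_pmf collect_unzip5;
     simp add: map_bind_pmf bind_assoc_pmf bind_return_pmf)

lemma fresh_law_block:
  "fresh_law (replicate_pmf n p0) (block_kernel p1) (block_kernel2 q1) (block_kernel p2) (block_kernel2 q2) (block_kernel2 ch) =
   map_pmf unzip5 (replicate_pmf n (fresh_law p0 p1 q1 p2 q2 ch))"
  unfolding fresh_law_def
  by (simp add: replicate_bind_block_kernel replicate_bind_replicate block_kernel_map zip_maps bind_return_pmf collect_unzip5)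
   (simp add: map_bind_pmf bind_assoc_pmf bind_return_pmf)

section \<open>Decoding error of the random code\<close>

lemma user_book_cloud:
  assumes "j < N"
  shows "(\<integral>\<^sup>+b. \<phi> (cloud b j) \<partial>user_book N A p q) = (\<integral>\<^sup>+w. \<phi> w \<partial>p)"
  using assms by (simp add: user_book_def cloud_def nn_integral_Pi_pmf_component)

lemma set_user_book:
  assumes "b \<in> set_pmf (user_book N A p q)" "finite A" "N > 0"
  shows "s \<in> A \<Longrightarrow> bin b s < N" "i < N \<Longrightarrow> cloud b i \<in> set_pmf p"
    "s \<in> A \<Longrightarrow> satellite b s \<in> set_pmf (q (cloud b (bin b s)))"
proof -
  have "set_pmf (pmf_of_set {..<N}) = {..<N}"
    using assms by (intro set_pmf_of_set) (auto simp: lessThan_empty_iff)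
  then obtain w hx where b: "b = (w, hx)" and w: "\<forall>i<N. w i \<in> set_pmf p"
    and hx: "\<forall>s\<in>A. \<exists>i<N. \<exists>x\<in>set_pmf (q (w i)). hx s = (i, x)"
    using assms by (auto simp: user_book_def set_Pi_pmf PiE_dflt_def Bex_def)
  show "bin b s < N" "satellite b s \<in> set_pmf (q (cloud b (bin b s)))" if "s \<in> A"
    using hx[rule_format, OF that] by (auto simp: b bin_def satellite_def cloud_def)
  show "cloud b i \<in> set_pmf p" if "i < N"
    using w that by (auto simp: b cloud_def)
qed

text \<open>The book of one block of \<open>K\<close>. Both encoders know that block, which is why a
  single \<open>w0\<close> can serve both users.\<close>

definition book where
  "book N1 A1 N2 A2 p0 p1 q1 p2 q2 = do {
     w0 \<leftarrow> p0; b1 \<leftarrow> user_book N1 A1 (p1 w0) (q1 w0); b2 \<leftarrow> user_book N2 A2 (p2 w0) (q2 w0);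
     return_pmf (w0, b1, b2)}"

definition input1 where "input1 c s = satellite (fst (snd c)) s"
definition input2 where "input2 c t = satellite (snd (snd c)) t"

text \<open>\<open>s\<close> is a message of the user whom the receiver decodes, while
  \<open>j\<close> is a guess at the bin of the other user.\<close>

definition candidate where
  "candidate c s j y = (fst c, cloud (fst (snd c)) (bin (fst (snd c)) s), input1 c s, cloud (snd (snd c)) j, y)"

text \<open>The guess \<open>j\<close> is quantified away: a right pair that fits through a wrong
  bin still counts as right.\<close>

definition decoded where
  "decoded M0 M1 N2 T c y = {(k, s). k \<in> M0 \<and> s \<in> M1 \<and> (\<exists>j<N2. candidate (c k) s j y \<in> T)}"

context
  fixes N1 N2 :: nat and A1 :: "'s set" and A2 :: "'t set"
    and p0 :: "'w0 pmf" and p1 :: "'w0 \<Rightarrow> 'w1 pmf" and q1 :: "'w0 \<Rightarrow> 'w1 \<Rightarrow> 'x1 pmf"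
    and p2 :: "'w0 \<Rightarrow> 'w2 pmf" and q2 :: "'w0 \<Rightarrow> 'w2 \<Rightarrow> 'x2 pmf" and ch :: "'x1 \<Rightarrow> 'x2 \<Rightarrow> 'y pmf"
    and T :: "('w0 \<times> 'w1 \<times> 'x1 \<times> 'w2 \<times> 'y) set"
  assumes fin: "finite A1" "finite A2" and pos: "N1 > 0" "N2 > 0"
begin

private abbreviation (input) "B \<equiv> book N1 A1 N2 A2 p0 p1 q1 p2 q2"
private abbreviation (input) "mixed b1 b2 \<equiv> emeasure (mixed_law b1 b2 p0 p1 q1 p2 q2 ch) T"

lemma true_candidate:
  assumes "s \<in> A1" "t \<in> A2"
  shows "(\<integral>\<^sup>+c. \<integral>\<^sup>+y. indicator (- T) (candidate c s (bin (snd (snd c)) t) y) \<partial>ch (input1 c s) (input2 c t) \<partial>B)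
    = emeasure (true_law p0 p1 q1 p2 q2 ch) (- T)"
proof -
  have "(\<integral>\<^sup>+c. \<integral>\<^sup>+y. indicator (- T) (candidate c s (bin (snd (snd c)) t) y) \<partial>ch (input1 c s) (input2 c t) \<partial>B)
    = (\<integral>\<^sup>+w0. \<integral>\<^sup>+b1. \<integral>\<^sup>+b2. \<integral>\<^sup>+y. indicator (- T)
         (w0, cloud b1 (bin b1 s), satellite b1 s, cloud b2 (bin b2 t), y)
         \<partial>ch (satellite b1 s) (satellite b2 t) \<partial>user_book N2 A2 (p2 w0) (q2 w0) \<partial>user_book N1 A1 (p1 w0) (q1 w0) \<partial>p0)"
    by (simp add: book_def candidate_def input1_def input2_def)
  also have "\<dots> = (\<integral>\<^sup>+w0. \<integral>\<^sup>+w1. \<integral>\<^sup>+x1. \<integral>\<^sup>+w2. \<integral>\<^sup>+x2. \<integral>\<^sup>+y. indicator (- T) (w0, w1, x1, w2, y)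
         \<partial>ch x1 x2 \<partial>q2 w0 w2 \<partial>p2 w0 \<partial>q1 w0 w1 \<partial>p1 w0 \<partial>p0)"
    using assms fin pos
    by (simp add: user_book_single[where \<phi> = "\<lambda>w2 x2. \<integral>\<^sup>+y. indicator (- T) (w0, w1, x1, w2, y) \<partial>ch x1 x2" for w0 w1 x1]
         user_book_single[where \<phi> = "\<lambda>w1 x1. \<integral>\<^sup>+w2. \<integral>\<^sup>+x2. \<integral>\<^sup>+y. indicator (- T) (w0, w1, x1, w2, y)
         \<partial>ch x1 x2 \<partial>q2 w0 w2 \<partial>p2 w0" for w0])
  also have "\<dots> = (\<integral>\<^sup>+z. indicator (- T) z \<partial>true_law p0 p1 q1 p2 q2 ch)"
    by (simp add: true_law_def del: nn_integral_indicator)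
  finally show ?thesis by simp
qed

text \<open>Averaging over the book of user 2 separates the right bin from wrong ones, with weights
  1 and \<open>N2\<close>; averaging over the book of user 1 separates a shared bin from different
  bins, with weights \<open>1 / N1\<close> and 1. The products are the four terms.\<close>

lemma candidate_same_block:
  assumes "s \<in> A1" "s' \<in> A1" "s \<noteq> s'" "t \<in> A2"
  shows "(\<Sum>j<N2. \<integral>\<^sup>+c. \<integral>\<^sup>+y. indicator T (candidate c s' j y) \<partial>ch (input1 c s) (input2 c t) \<partial>B)
    \<le> (mixed True True + of_nat N2 * mixed True False) / of_nat N1 + mixed False True + of_nat N2 * mixed False False"
proof -
  let ?u1 = "\<lambda>w0. user_book N1 A1 (p1 w0) (q1 w0)" and ?u2 = "\<lambda>w0. user_book N2 A2 (p2 w0) (q2 w0)"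
  define F where "F w0 x1 w1' x1' x2 w2' = (\<integral>\<^sup>+y. indicator T (w0, w1', x1', w2', y) \<partial>ch x1 x2)" for w0 x1 w1' x1' x2 w2'
  \<comment> \<open>What is left after averaging over user 2, for fixed data of user 1: the right
    bin, plus \<open>N2\<close> times a wrong one.\<close>
  define G where "G w0 x1 w1' x1' = (\<integral>\<^sup>+w2. \<integral>\<^sup>+x2. F w0 x1 w1' x1' x2 w2 \<partial>q2 w0 w2 \<partial>p2 w0)
     + of_nat N2 * (\<integral>\<^sup>+w2. \<integral>\<^sup>+x2. \<integral>\<^sup>+w2'. F w0 x1 w1' x1' x2 w2' \<partial>p2 w0 \<partial>q2 w0 w2 \<partial>p2 w0)" for w0 x1 w1' x1'
  have "(\<Sum>j<N2. \<integral>\<^sup>+c. \<integral>\<^sup>+y. indicator T (candidate c s' j y) \<partial>ch (input1 c s) (input2 c t) \<partial>B)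
    = (\<integral>\<^sup>+w0. \<integral>\<^sup>+b1. (\<Sum>j<N2. \<integral>\<^sup>+b2. F w0 (satellite b1 s) (cloud b1 (bin b1 s')) (satellite b1 s') (satellite b2 t) (cloud b2 j)
        \<partial>?u2 w0) \<partial>?u1 w0 \<partial>p0)"
    by (simp add: book_def candidate_def input1_def input2_def F_def nn_integral_sum)
  also have "\<dots> \<le> (\<integral>\<^sup>+w0. \<integral>\<^sup>+b1. G w0 (satellite b1 s) (cloud b1 (bin b1 s')) (satellite b1 s') \<partial>?u1 w0 \<partial>p0)"
    unfolding G_def using fin pos assms
    by (intro nn_integral_mono user_book_cloud_le[where \<phi> = "\<lambda>w2 x2 w2'. F w0 x1 w1' x1' x2 w2'" for w0 x1 w1' x1'])
  also have "\<dots> \<le> (\<integral>\<^sup>+w0. (\<integral>\<^sup>+w1. \<integral>\<^sup>+x1. \<integral>\<^sup>+x1'. G w0 x1 w1 x1' \<partial>q1 w0 w1 \<partial>q1 w0 w1 \<partial>p1 w0) / of_nat N1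
      + (\<integral>\<^sup>+w1. \<integral>\<^sup>+x1. \<integral>\<^sup>+w1'. \<integral>\<^sup>+x1'. G w0 x1 w1' x1' \<partial>q1 w0 w1' \<partial>p1 w0 \<partial>q1 w0 w1 \<partial>p1 w0) \<partial>p0)"
    using fin pos assms
    by (intro nn_integral_mono user_book_pair_le[where \<phi> = "\<lambda>w1 x1 w1' x1'. G w0 x1 w1' x1'" for w0])
  also have "\<dots> = (\<integral>\<^sup>+w0. (\<integral>\<^sup>+w1. \<integral>\<^sup>+x1. \<integral>\<^sup>+x1'. G w0 x1 w1 x1' \<partial>q1 w0 w1 \<partial>q1 w0 w1 \<partial>p1 w0) \<partial>p0) / of_nat N1
      + (\<integral>\<^sup>+w0. \<integral>\<^sup>+w1. \<integral>\<^sup>+x1. \<integral>\<^sup>+w1'. \<integral>\<^sup>+x1'. G w0 x1 w1' x1' \<partial>q1 w0 w1' \<partial>p1 w0 \<partial>q1 w0 w1 \<partial>p1 w0 \<partial>p0)"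
    by (simp add: nn_integral_add nn_integral_divide)
  also have "(\<integral>\<^sup>+w0. (\<integral>\<^sup>+w1. \<integral>\<^sup>+x1. \<integral>\<^sup>+x1'. G w0 x1 w1 x1' \<partial>q1 w0 w1 \<partial>q1 w0 w1 \<partial>p1 w0) \<partial>p0)
    = (\<integral>\<^sup>+z. indicator T z \<partial>mixed_law True True p0 p1 q1 p2 q2 ch)
      + of_nat N2 * (\<integral>\<^sup>+z. indicator T z \<partial>mixed_law True False p0 p1 q1 p2 q2 ch)"
    by (simp add: G_def F_def mixed_law_def nn_integral_add nn_integral_cmult bind_return_pmf del: nn_integral_indicator)
  also have "(\<integral>\<^sup>+w0. \<integral>\<^sup>+w1. \<integral>\<^sup>+x1. \<integral>\<^sup>+w1'. \<integral>\<^sup>+x1'. G w0 x1 w1' x1' \<partial>q1 w0 w1' \<partial>p1 w0 \<partial>q1 w0 w1 \<partial>p1 w0 \<partial>p0)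
    = (\<integral>\<^sup>+z. indicator T z \<partial>mixed_law False True p0 p1 q1 p2 q2 ch)
      + of_nat N2 * (\<integral>\<^sup>+z. indicator T z \<partial>mixed_law False False p0 p1 q1 p2 q2 ch)"
    by (simp add: G_def F_def mixed_law_def nn_integral_add nn_integral_cmult bind_return_pmf del: nn_integral_indicator)
  finally show ?thesis by (simp add: add.assoc)
qed

lemma candidate_other_block:
  assumes "s \<in> A1" "s' \<in> A1" "t \<in> A2" "j < N2"
  shows "(\<integral>\<^sup>+c. \<integral>\<^sup>+c'. \<integral>\<^sup>+y. indicator T (candidate c' s' j y) \<partial>ch (input1 c s) (input2 c t) \<partial>B \<partial>B)
    = emeasure (fresh_law p0 p1 q1 p2 q2 ch) T"
proof -
  let ?u1 = "\<lambda>w0. user_book N1 A1 (p1 w0) (q1 w0)" and ?u2 = "\<lambda>w0. user_book N2 A2 (p2 w0) (q2 w0)"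
  define H where "H y = (\<integral>\<^sup>+w0. \<integral>\<^sup>+w1. \<integral>\<^sup>+x1. \<integral>\<^sup>+w2. indicator T (w0, w1, x1, w2, y) \<partial>p2 w0 \<partial>q1 w0 w1 \<partial>p1 w0 \<partial>p0)" for y
  have "(\<integral>\<^sup>+c'. indicator T (candidate c' s' j y) \<partial>B) = H y" for y
  proof -
    have "(\<integral>\<^sup>+c'. indicator T (candidate c' s' j y) \<partial>B)
      = (\<integral>\<^sup>+w0. \<integral>\<^sup>+b1. \<integral>\<^sup>+b2. indicator T (w0, cloud b1 (bin b1 s'), satellite b1 s', cloud b2 j, y) \<partial>?u2 w0 \<partial>?u1 w0 \<partial>p0)"
      by (simp add: book_def candidate_def input1_def)
    also have "\<dots> = H y"
      using assms fin pos
      by (simp add: H_def user_book_cloud[where \<phi> = "\<lambda>w2. indicator T (w0, w1, x1, w2, y)" for w0 w1 x1]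
         user_book_single[where \<phi> = "\<lambda>w1 x1. \<integral>\<^sup>+w2. indicator T (w0, w1, x1, w2, y) \<partial>p2 w0" for w0])
    finally show ?thesis .
  qed
  \<comment> \<open>The output is produced by \<open>c\<close> alone, so the independent book
    \<open>c'\<close> can be averaged first, with \<open>y\<close> fixed.\<close>
  then have "(\<integral>\<^sup>+c. \<integral>\<^sup>+c'. \<integral>\<^sup>+y. indicator T (candidate c' s' j y) \<partial>ch (input1 c s) (input2 c t) \<partial>B \<partial>B)
    = (\<integral>\<^sup>+c. \<integral>\<^sup>+y. H y \<partial>ch (input1 c s) (input2 c t) \<partial>B)"
    by (subst nn_integral_pmf_commute) simp
  also have "\<dots> = (\<integral>\<^sup>+w0. \<integral>\<^sup>+b1. \<integral>\<^sup>+b2. \<integral>\<^sup>+y. H y \<partial>ch (satellite b1 s) (satellite b2 t) \<partial>?u2 w0 \<partial>?u1 w0 \<partial>p0)"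
    by (simp add: book_def input1_def input2_def)
  also have "\<dots> = (\<integral>\<^sup>+w0. \<integral>\<^sup>+w1. \<integral>\<^sup>+x1. \<integral>\<^sup>+w2. \<integral>\<^sup>+x2. \<integral>\<^sup>+y. H y \<partial>ch x1 x2 \<partial>q2 w0 w2 \<partial>p2 w0 \<partial>q1 w0 w1 \<partial>p1 w0 \<partial>p0)"
    using assms fin pos
    by (simp add: user_book_single[where \<phi> = "\<lambda>w2 x2. \<integral>\<^sup>+y. H y \<partial>ch x1 x2" for x1]
         user_book_single[where \<phi> = "\<lambda>w1 x1. \<integral>\<^sup>+w2. \<integral>\<^sup>+x2. \<integral>\<^sup>+y. H y \<partial>ch x1 x2 \<partial>q2 w0 w2 \<partial>p2 w0" for w0])
  also have "\<dots> = (\<integral>\<^sup>+z. indicator T z \<partial>fresh_law p0 p1 q1 p2 q2 ch)"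
    by (simp add: fresh_law_def H_def del: nn_integral_indicator)
  finally show ?thesis by simp
qed

lemma bin_less: "c \<in> set_pmf B \<Longrightarrow> t \<in> A2 \<Longrightarrow> bin (snd (snd c)) t < N2"
  using fin pos set_user_book[of _ N2 A2] by (fastforce simp: book_def)

text \<open>A union bound: the right pair is missed because a source block is outside its search set
  or the true tuple fails the test, or else a wrong pair passes with some bin. Wrong pairs are
  grouped by their block of \<open>K\<close>, since they share a book with the truth only if that
  block is right.\<close>

lemma decoding_error_le:
  assumes "finite A0" "k \<in> A0" "s \<in> A1" "t \<in> A2" "M0 \<subseteq> A0" "M1 \<subseteq> A1"
  shows "(\<integral>\<^sup>+c. emeasure (ch (input1 (c k) s) (input2 (c k) t)) {y. decoded M0 M1 N2 T c y \<noteq> {(k, s)}} \<partial>Pi_pmf A0 d (\<lambda>_. B))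
    \<le> indicator (- M0) k + indicator (- M1) s + emeasure (true_law p0 p1 q1 p2 q2 ch) (- T)
      + of_nat (card M1) * ((mixed True True + of_nat N2 * mixed True False) / of_nat N1
          + mixed False True + of_nat N2 * mixed False False)
      + of_nat (card M0) * (of_nat (card M1) * (of_nat N2 * emeasure (fresh_law p0 p1 q1 p2 q2 ch) T))"
proof -
  let ?C = "Pi_pmf A0 d (\<lambda>_. B)"
  let ?ch = "\<lambda>c. ch (input1 (c k) s) (input2 (c k) t)"
  have finM: "finite M0" "finite M1" using assms fin by (auto intro: finite_subset)
  have pointwise: "(indicator {y. decoded M0 M1 N2 T c y \<noteq> {(k, s)}} y :: ennreal)
    \<le> indicator (- M0) k + indicator (- M1) s + indicator (- T) (candidate (c k) s (bin (snd (snd (c k))) t) y)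
      + (\<Sum>s'\<in>M1 - {s}. \<Sum>j<N2. indicator T (candidate (c k) s' j y))
      + (\<Sum>k'\<in>M0 - {k}. \<Sum>s'\<in>M1. \<Sum>j<N2. indicator T (candidate (c k') s' j y))" (is "_ \<le> ?r1 + ?r2 + ?r3 + ?r4 + ?r5")
    if c: "c \<in> set_pmf ?C" for c y
  proof (cases "decoded M0 M1 N2 T c y = {(k, s)}")
    case False
    \<comment> \<open>The true bin is among the indices searched, so a right pair inside the search
      sets is found whenever the true tuple lies in \<open>T\<close>.\<close>
    have b: "bin (snd (snd (c k))) t < N2"
      using c assms by (intro bin_less) (auto simp: set_Pi_pmf PiE_dflt_def)
    have one_le: "1 \<le> (\<Sum>x\<in>X. f x)" if "finite X" "x \<in> X" "1 \<le> f x" for X and x :: 'u and f :: "'u \<Rightarrow> ennreal"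
      using member_le_sum[of x X f] that by (auto intro: order_trans)
    consider "k \<notin> M0" | "s \<notin> M1" | "candidate (c k) s (bin (snd (snd (c k))) t) y \<notin> T"
      | k' s' j where "k' \<in> M0" "s' \<in> M1" "j < N2" "candidate (c k') s' j y \<in> T" "(k', s') \<noteq> (k, s)"
      using False b unfolding decoded_def by blast
    then have "1 \<le> ?r1 \<or> 1 \<le> ?r2 \<or> 1 \<le> ?r3 \<or> 1 \<le> ?r4 \<or> 1 \<le> ?r5"
    proof cases
      case 4
      have j: "1 \<le> (\<Sum>j<N2. indicator T (candidate (c k') s' j y) :: ennreal)"
        using 4 by (intro one_le[of _ j]) auto
      show ?thesis
      proof (cases "k' = k")
        case True
        then have "1 \<le> ?r4" using 4 j finM by (intro one_le[of _ s']) auto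
        then show ?thesis by blast
      next
        case False
        then have "1 \<le> ?r5" using 4 j finM by (intro one_le[of _ k'] one_le[of _ s']) auto
        then show ?thesis by blast
      qed
    qed auto
    then show ?thesis
      by (elim disjE) (auto intro: order_trans[OF _ add_increasing2] add_increasing add_increasing2 simp: indicator_def[of "{y. _ y}"] simp del: sum_eq_0_iff)
  qed auto
  have "(\<integral>\<^sup>+c. emeasure (?ch c) {y. decoded M0 M1 N2 T c y \<noteq> {(k, s)}} \<partial>?C)
    = (\<integral>\<^sup>+c. \<integral>\<^sup>+y. indicator {y. decoded M0 M1 N2 T c y \<noteq> {(k, s)}} y \<partial>?ch c \<partial>?C)"
    by simp
  also have "\<dots> \<le> (\<integral>\<^sup>+c. \<integral>\<^sup>+y. indicator (- M0) k + indicator (- M1) s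
      + indicator (- T) (candidate (c k) s (bin (snd (snd (c k))) t) y)
      + (\<Sum>s'\<in>M1 - {s}. \<Sum>j<N2. indicator T (candidate (c k) s' j y))
      + (\<Sum>k'\<in>M0 - {k}. \<Sum>s'\<in>M1. \<Sum>j<N2. indicator T (candidate (c k') s' j y)) \<partial>?ch c \<partial>?C)"
    by (intro nn_integral_mono_AE AE_pmfI nn_integral_mono pointwise)
  also have "\<dots> = indicator (- M0) k + indicator (- M1) s
      + (\<integral>\<^sup>+c. \<integral>\<^sup>+y. indicator (- T) (candidate (c k) s (bin (snd (snd (c k))) t) y) \<partial>?ch c \<partial>?C)
      + (\<Sum>s'\<in>M1 - {s}. \<Sum>j<N2. \<integral>\<^sup>+c. \<integral>\<^sup>+y. indicator T (candidate (c k) s' j y) \<partial>?ch c \<partial>?C)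
      + (\<Sum>k'\<in>M0 - {k}. \<Sum>s'\<in>M1. \<Sum>j<N2. \<integral>\<^sup>+c. \<integral>\<^sup>+y. indicator T (candidate (c k') s' j y) \<partial>?ch c \<partial>?C)"
    by (simp add: nn_integral_add nn_integral_sum del: nn_integral_indicator)
  also have "(\<integral>\<^sup>+c. \<integral>\<^sup>+y. indicator (- T) (candidate (c k) s (bin (snd (snd (c k))) t) y) \<partial>?ch c \<partial>?C)
    = emeasure (true_law p0 p1 q1 p2 q2 ch) (- T)"
    using assms true_candidate
    by (subst nn_integral_Pi_pmf_component[where \<phi> = "\<lambda>c. \<integral>\<^sup>+y. indicator (- T) (candidate c s (bin (snd (snd c)) t) y)
      \<partial>ch (input1 c s) (input2 c t)"]) auto
  also have "(\<Sum>s'\<in>M1 - {s}. \<Sum>j<N2. \<integral>\<^sup>+c. \<integral>\<^sup>+y. indicator T (candidate (c k) s' j y) \<partial>?ch c \<partial>?C)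
    = (\<Sum>s'\<in>M1 - {s}. \<Sum>j<N2. \<integral>\<^sup>+c. \<integral>\<^sup>+y. indicator T (candidate c s' j y) \<partial>ch (input1 c s) (input2 c t) \<partial>B)"
    using assms
    by (intro sum.cong refl nn_integral_Pi_pmf_component[where \<phi> = "\<lambda>c. \<integral>\<^sup>+y. indicator T (candidate c s' j y)
      \<partial>ch (input1 c s) (input2 c t)" for s' j]) auto
  also have "\<dots> \<le> (\<Sum>s'\<in>M1 - {s}. (mixed True True + of_nat N2 * mixed True False) / of_nat N1
          + mixed False True + of_nat N2 * mixed False False)"
    using assms by (intro sum_mono candidate_same_block) auto
  also have "\<dots> \<le> of_nat (card M1) * ((mixed True True + of_nat N2 * mixed True False) / of_nat N1
          + mixed False True + of_nat N2 * mixed False False)"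
    using finM by (simp, intro mult_right_mono) (auto intro!: card_mono)
  also have "(\<Sum>k'\<in>M0 - {k}. \<Sum>s'\<in>M1. \<Sum>j<N2. \<integral>\<^sup>+c. \<integral>\<^sup>+y. indicator T (candidate (c k') s' j y) \<partial>?ch c \<partial>?C)
    = (\<Sum>k'\<in>M0 - {k}. \<Sum>s'\<in>M1. \<Sum>j<N2. emeasure (fresh_law p0 p1 q1 p2 q2 ch) T)"
  proof (intro sum.cong refl)
    fix k' s' j assume *: "k' \<in> M0 - {k}" "s' \<in> M1" "j \<in> {..<N2}"
    have "(\<integral>\<^sup>+c. \<integral>\<^sup>+y. indicator T (candidate (c k') s' j y) \<partial>?ch c \<partial>?C)
      = (\<integral>\<^sup>+c. \<integral>\<^sup>+c'. \<integral>\<^sup>+y. indicator T (candidate c' s' j y) \<partial>ch (input1 c s) (input2 c t) \<partial>B \<partial>B)"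
      using assms * by (intro nn_integral_Pi_pmf_component2[where \<phi> = "\<lambda>c c'. \<integral>\<^sup>+y. indicator T (candidate c' s' j y)
        \<partial>ch (input1 c s) (input2 c t)"]) auto
    also have "\<dots> = emeasure (fresh_law p0 p1 q1 p2 q2 ch) T"
      using assms * by (intro candidate_other_block) auto
    finally show "(\<integral>\<^sup>+c. \<integral>\<^sup>+y. indicator T (candidate (c k') s' j y) \<partial>?ch c \<partial>?C) = emeasure (fresh_law p0 p1 q1 p2 q2 ch) T" .
  qed
  also have "\<dots> \<le> of_nat (card M0) * (of_nat (card M1) * (of_nat N2 * emeasure (fresh_law p0 p1 q1 p2 q2 ch) T))"
    using finM by (simp, intro mult_right_mono) (auto intro!: card_mono)
  finally show ?thesis by (simp add: add_mono)
qed

end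

section \<open>Typical blocks\<close>

lemma squeeze_0:
  fixes f g :: "nat \<Rightarrow> real"
  assumes "\<And>n. 0 \<le> f n" "\<And>n. f n \<le> g n" "g \<longlonglongrightarrow> 0"
  shows "f \<longlonglongrightarrow> 0"
  by (rule tendsto_sandwich[OF _ _ tendsto_const assms(3)]) (simp_all add: assms)

lemma measure_pmf_mono_support:
  assumes "\<And>x. x \<in> set_pmf p \<Longrightarrow> x \<in> A \<Longrightarrow> x \<in> B"
  shows "measure_pmf.prob p A \<le> measure_pmf.prob p B"
  using assms by (intro measure_pmf.finite_measure_mono_AE AE_pmfI) auto

lemma nn_integral_replicate_pmf_prod:
  "(\<integral>\<^sup>+zs. (\<Prod>z\<leftarrow>zs. h z) \<partial>replicate_pmf n p) = (\<integral>\<^sup>+z. h z \<partial>p) ^ n" for h :: "'a \<Rightarrow> ennreal"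
  by (induction n) (simp_all add: nn_integral_cmult nn_integral_multc)

text \<open>Chernoff bound, with an exponent at which the moment generating function is below \<open>1\<close>.\<close>

lemma replicate_pmf_sum_le_0_tendsto:
  fixes g :: "'a \<Rightarrow> real"
  assumes fin: "finite (set_pmf p)" and pos: "measure_pmf.expectation p g > 0"
  shows "(\<lambda>n. measure_pmf.prob (replicate_pmf n p) {zs. (\<Sum>z\<leftarrow>zs. g z) \<le> 0}) \<longlonglongrightarrow> 0"
proof -
  define \<phi> where "\<phi> l = (\<Sum>z\<in>set_pmf p. exp (- l * g z) * pmf p z)" for l
  let ?m = "\<Sum>z\<in>set_pmf p. g z * pmf p z"
  have der: "(\<phi> has_real_derivative - ?m) (at 0)"
    unfolding \<phi>_def by (auto intro!: derivative_eq_intros simp: sum_negf)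
  have "measure_pmf.expectation p g = ?m"
    using fin by (subst integral_measure_pmf_real[of "set_pmf p"]) auto
  then have neg: "- ?m < 0" using pos by simp
  \<comment> \<open>The derivative at 0 of the moment generating function is minus the mean, so the
    function drops below its value 1 just to the right of 0.\<close>
  obtain d where d: "d > 0" "\<And>h. 0 < h \<Longrightarrow> h < d \<Longrightarrow> \<phi> h < \<phi> 0"
    using DERIV_neg_dec_right[OF der neg] by auto
  define l where "l = d / 2"
  have "\<phi> 0 = 1" using fin by (simp add: \<phi>_def sum_pmf_eq_1)
  then have l: "l > 0" "\<phi> l < 1" using d(1) d(2)[of l] by (auto simp: l_def)
  have nonneg: "\<phi> l \<ge> 0" by (auto simp: \<phi>_def intro!: sum_nonneg)
  have "measure_pmf.prob (replicate_pmf n p) {zs. (\<Sum>z\<leftarrow>zs. g z) \<le> 0} \<le> \<phi> l ^ n" for n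
  proof -
    have "ennreal (measure_pmf.prob (replicate_pmf n p) {zs. (\<Sum>z\<leftarrow>zs. g z) \<le> 0})
      = (\<integral>\<^sup>+zs. indicator {zs. (\<Sum>z\<leftarrow>zs. g z) \<le> 0} zs \<partial>replicate_pmf n p)"
      by (simp add: measure_pmf.emeasure_eq_measure)
    also have "\<dots> \<le> (\<integral>\<^sup>+zs. (\<Prod>z\<leftarrow>zs. ennreal (exp (- l * g z))) \<partial>replicate_pmf n p)"
    proof (intro nn_integral_mono)
      fix zs
      have "(\<Prod>z\<leftarrow>zs. ennreal (exp (- l * g z))) = ennreal (exp (- l * (\<Sum>z\<leftarrow>zs. g z)))"
      proof (induction zs)
        case (Cons z zs)
        have "exp (- l * (\<Sum>z\<leftarrow>z # zs. g z)) = exp (- l * g z) * exp (- l * (\<Sum>z\<leftarrow>zs. g z))"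
          by (simp add: distrib_left exp_diff exp_minus divide_inverse)
        then show ?case using Cons by (simp only: list.map prod_list.Cons ennreal_mult exp_ge_zero)
      qed simp
      moreover have "1 \<le> ennreal (exp (- l * (\<Sum>z\<leftarrow>zs. g z)))" if "(\<Sum>z\<leftarrow>zs. g z) \<le> 0"
        using l that by (auto intro: mult_nonneg_nonpos)
      ultimately show "indicator {zs. (\<Sum>z\<leftarrow>zs. g z) \<le> 0} zs \<le> (\<Prod>z\<leftarrow>zs. ennreal (exp (- l * g z)))"
        by (auto simp: indicator_def)
    qed
    also have "\<dots> = (\<integral>\<^sup>+z. ennreal (exp (- l * g z)) \<partial>p) ^ n"
      by (rule nn_integral_replicate_pmf_prod)
    also have "(\<integral>\<^sup>+z. ennreal (exp (- l * g z)) \<partial>p) = ennreal (\<phi> l)"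
      unfolding \<phi>_def by (subst nn_integral_measure_pmf_finite[OF fin])
        (simp_all add: ennreal_mult flip: sum_ennreal)
    finally show ?thesis using nonneg by (simp add: ennreal_power)
  qed
  then show ?thesis
    by (rule squeeze_0[OF measure_nonneg]) (rule LIMSEQ_realpow_zero[OF nonneg l(2)])
qed

text \<open>The support assumption matters: a letter of probability zero makes the left side 0,
  while a power of 2 is positive.\<close>

lemma pmf_replicate_eq:
  assumes "set zs \<subseteq> set_pmf p"
  shows "pmf (replicate_pmf (length zs) p) zs = 2 powr (\<Sum>z\<leftarrow>zs. log 2 (pmf p z))"
  using assms
proof (induction zs)
  case (Cons z zs)
  then have "pmf p z > 0" by (auto simp: pmf_positive)
  then show ?case using Cons by (auto simp: pmf_bind_Cons powr_add)
qed simp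

lemma expectation_diff_diff:
  fixes f g :: "'a \<Rightarrow> real"
  assumes "finite (set_pmf p)"
  shows "measure_pmf.expectation p (\<lambda>z. f z - g z - c) = measure_pmf.expectation p f - measure_pmf.expectation p g - c"
proof -
  have "integrable p h" for h :: "'a \<Rightarrow> real" using assms by (rule integrable_measure_pmf_finite)
  then show ?thesis by simp
qed

text \<open>The log-likelihood ratio of a block is a sum of i.i.d. terms whose mean, the divergence,
  exceeds \<open>r\<close>. Inclusion of the supports makes every term a genuine log ratio.\<close>

lemma likelihood_ratio_tendsto:
  fixes p q :: "'a pmf" and r :: real
  assumes fin: "finite (set_pmf p)" and sub: "set_pmf p \<subseteq> set_pmf q"
    and r: "r < measure_pmf.expectation p (\<lambda>z. log 2 (pmf p z)) - measure_pmf.expectation p (\<lambda>z. log 2 (pmf q z))"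
  shows "(\<lambda>n. measure_pmf.prob (replicate_pmf n p)
    {zs. pmf (replicate_pmf n p) zs \<le> 2 powr (n * r) * pmf (replicate_pmf n q) zs}) \<longlonglongrightarrow> 0"
proof -
  define g where "g z = log 2 (pmf p z) - log 2 (pmf q z) - r" for z
  have "measure_pmf.prob (replicate_pmf n p) {zs. pmf (replicate_pmf n p) zs \<le> 2 powr (n * r) * pmf (replicate_pmf n q) zs}
    \<le> measure_pmf.prob (replicate_pmf n p) {zs. (\<Sum>z\<leftarrow>zs. g z) \<le> 0}" for n
  proof (rule measure_pmf_mono_support)
    fix zs assume zs: "zs \<in> set_pmf (replicate_pmf n p)"
      "zs \<in> {zs. pmf (replicate_pmf n p) zs \<le> 2 powr (n * r) * pmf (replicate_pmf n q) zs}"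
    then have len: "length zs = n" and sp: "set zs \<subseteq> set_pmf p" by (auto simp: set_replicate_pmf)
    have "2 powr (\<Sum>z\<leftarrow>zs. log 2 (pmf p z)) \<le> 2 powr (n * r + (\<Sum>z\<leftarrow>zs. log 2 (pmf q z)))"
      using zs(2) pmf_replicate_eq[OF sp] pmf_replicate_eq[of zs q] sp sub len by (auto simp: powr_add)
    then have "(\<Sum>z\<leftarrow>zs. log 2 (pmf p z)) \<le> n * r + (\<Sum>z\<leftarrow>zs. log 2 (pmf q z))" by simp
    moreover have "(\<Sum>z\<leftarrow>zs. g z) = (\<Sum>z\<leftarrow>zs. log 2 (pmf p z)) - (\<Sum>z\<leftarrow>zs. log 2 (pmf q z)) - n * r"
      using len by (simp add: g_def sum_list_subtractf sum_list_triv)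
    ultimately show "zs \<in> {zs. (\<Sum>z\<leftarrow>zs. g z) \<le> 0}" by simp
  qed
  moreover have "(\<lambda>n. measure_pmf.prob (replicate_pmf n p) {zs. (\<Sum>z\<leftarrow>zs. g z) \<le> 0}) \<longlonglongrightarrow> 0"
  proof (rule replicate_pmf_sum_le_0_tendsto[OF fin])
    have "measure_pmf.expectation p g
      = measure_pmf.expectation p (\<lambda>z. log 2 (pmf p z)) - measure_pmf.expectation p (\<lambda>z. log 2 (pmf q z)) - r"
      unfolding g_def by (rule expectation_diff_diff[OF fin])
    then show "0 < measure_pmf.expectation p g" using r by linarith
  qed
  ultimately show ?thesis
    by (rule squeeze_0[OF measure_nonneg])
qed

text \<open>One-sided typicality: a lower bound on the probability is what counting the blocks
  requires.\<close>

definition typical :: "real \<Rightarrow> nat \<Rightarrow> 'a pmf \<Rightarrow> 'a list set" where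
  "typical r n p = {zs. pmf (replicate_pmf n p) zs \<ge> 2 powr (- n * r)}"

lemma typical_subset: "typical r n p \<subseteq> blocks n"
proof
  fix zs assume "zs \<in> typical r n p"
  then have "0 < pmf (replicate_pmf n p) zs"
    using order.strict_trans2[of 0 "2 powr (- real n * r)"] by (auto simp: typical_def)
  then have "zs \<in> set_pmf (replicate_pmf n p)" by (simp add: set_pmf_iff)
  then show "zs \<in> blocks n" by (simp add: set_replicate_pmf blocks_def)
qed

lemma finite_blocks: "finite (blocks n :: 'a::finite list set)"
  using finite_lists_length_eq[of "UNIV :: 'a set" n] by (simp add: blocks_def)

text \<open>Point masses of at least \<open>2 powr (- n * r)\<close> add up to at most 1.\<close>

lemma card_typical:
  fixes p :: "'a::finite pmf"
  shows "real (card (typical r n p)) \<le> 2 powr (n * r)"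
proof -
  have fin: "finite (typical r n p)" using typical_subset finite_blocks by (rule finite_subset)
  have "card (typical r n p) * 2 powr (- n * r) = (\<Sum>zs\<in>typical r n p. 2 powr (- n * r))" by simp
  also have "\<dots> \<le> (\<Sum>zs\<in>typical r n p. pmf (replicate_pmf n p) zs)"
    by (intro sum_mono) (simp add: typical_def)
  also have "\<dots> \<le> 1" using fin by (simp add: flip: measure_measure_pmf_finite)
  finally have "card (typical r n p) / 2 powr (n * r) \<le> 1" by (simp add: powr_minus_divide)
  then show ?thesis by (subst (asm) pos_divide_le_eq) auto
qed

lemma typical_tendsto:
  fixes p :: "'a::finite pmf"
  assumes "r > - measure_pmf.expectation p (\<lambda>z. log 2 (pmf p z))"
  shows "(\<lambda>n. measure_pmf.prob (replicate_pmf n p) (- typical r n p)) \<longlonglongrightarrow> 0"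
proof -
  define g where "g z = log 2 (pmf p z) + r" for z
  have "measure_pmf.prob (replicate_pmf n p) (- typical r n p)
    \<le> measure_pmf.prob (replicate_pmf n p) {zs. (\<Sum>z\<leftarrow>zs. g z) \<le> 0}" for n
  proof (rule measure_pmf_mono_support)
    fix zs assume zs: "zs \<in> set_pmf (replicate_pmf n p)" "zs \<in> - typical r n p"
    then have len: "length zs = n" and sp: "set zs \<subseteq> set_pmf p" by (auto simp: set_replicate_pmf)
    have "2 powr (\<Sum>z\<leftarrow>zs. log 2 (pmf p z)) < 2 powr (- n * r)"
      using zs(2) pmf_replicate_eq[OF sp] len by (auto simp: typical_def)
    then have "(\<Sum>z\<leftarrow>zs. log 2 (pmf p z)) < - n * r" by simp
    moreover have "(\<Sum>z\<leftarrow>zs. g z) = (\<Sum>z\<leftarrow>zs. log 2 (pmf p z)) + n * r"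
      using len by (simp add: g_def sum_list_addf sum_list_triv)
    ultimately show "zs \<in> {zs. (\<Sum>z\<leftarrow>zs. g z) \<le> 0}" by simp
  qed
  moreover have "measure_pmf.expectation p g = measure_pmf.expectation p (\<lambda>z. log 2 (pmf p z)) + r"
    using expectation_diff_diff[of p "\<lambda>z. log 2 (pmf p z)" "\<lambda>_. 0" "- r"] unfolding g_def by simp
  then have "(\<lambda>n. measure_pmf.prob (replicate_pmf n p) {zs. (\<Sum>z\<leftarrow>zs. g z) \<le> 0}) \<longlonglongrightarrow> 0"
    using assms by (intro replicate_pmf_sum_le_0_tendsto) auto
  ultimately show ?thesis
    by (rule squeeze_0[OF measure_nonneg])
qed

section \<open>Asymptotics of the random code\<close>

text \<open>\<open>None\<close> is the case of a wrong block of \<open>K\<close>.\<close>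

type_synonym wrong = "(bool \<times> bool) option"

definition wrong_law where
  "wrong_law i p0 p1 q1 p2 q2 ch = (case i of
     None \<Rightarrow> fresh_law p0 p1 q1 p2 q2 ch
   | Some (b1, b2) \<Rightarrow> mixed_law b1 b2 p0 p1 q1 p2 q2 ch)"

lemma wrong_law_block:
  "wrong_law i (replicate_pmf n p0) (block_kernel p1) (block_kernel2 q1) (block_kernel p2) (block_kernel2 q2) (block_kernel2 ch) =
   map_pmf unzip5 (replicate_pmf n (wrong_law i p0 p1 q1 p2 q2 ch))"
  by (simp add: wrong_law_def fresh_law_block mixed_law_block split: option.split prod.split)

text \<open>A wrong candidate may by chance redraw exactly the true values. Hence the true law is
  absolutely continuous with respect to every wrong law, as \<open>likelihood_ratio_tendsto\<close>
  requires.\<close>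

lemma set_true_law_subset:
  "set_pmf (true_law p0 p1 q1 p2 q2 ch) \<subseteq> set_pmf (wrong_law i p0 p1 q1 p2 q2 ch)"
proof
  fix z assume "z \<in> set_pmf (true_law p0 p1 q1 p2 q2 ch)"
  then obtain w0 w1 x1 w2 x2 y where z: "z = (w0, w1, x1, w2, y)" and s: "w0 \<in> set_pmf p0" "w1 \<in> set_pmf (p1 w0)"
    "x1 \<in> set_pmf (q1 w0 w1)" "w2 \<in> set_pmf (p2 w0)" "x2 \<in> set_pmf (q2 w0 w2)" "y \<in> set_pmf (ch x1 x2)"
    by (auto simp: true_law_def)
  have "z \<in> set_pmf (mixed_law b1 b2 p0 p1 q1 p2 q2 ch)" for b1 b2
    unfolding mixed_law_def z using s
    by (cases b1; cases b2; simp; blast)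
  moreover have "z \<in> set_pmf (fresh_law p0 p1 q1 p2 q2 ch)"
    unfolding fresh_law_def z using s by simp blast
  ultimately show "z \<in> set_pmf (wrong_law i p0 p1 q1 p2 q2 ch)"
    by (simp add: wrong_law_def split: option.split prod.split)
qed

text \<open>Change of measure: on \<open>T\<close> the masses of \<open>q\<close> are at most those
  of \<open>p\<close> divided by \<open>c\<close>, and \<open>p\<close> has total mass 1.\<close>

lemma emeasure_likely_le:
  assumes "\<And>z. z \<in> T \<Longrightarrow> c * pmf q z \<le> pmf p z" "c > 0"
  shows "emeasure (measure_pmf q) T \<le> ennreal (1 / c)"
proof -
  have "emeasure (measure_pmf q) T = (\<integral>\<^sup>+z. pmf q z \<partial>count_space T)" by (rule nn_integral_pmf[symmetric])
  also have "\<dots> \<le> (\<integral>\<^sup>+z. ennreal (1 / c) * pmf p z \<partial>count_space T)"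
    using assms by (intro nn_integral_mono) (auto simp: field_simps simp flip: ennreal_mult')
  also have "\<dots> = ennreal (1 / c) * emeasure (measure_pmf p) T"
    by (simp add: nn_integral_cmult nn_integral_pmf)
  also have "\<dots> \<le> ennreal (1 / c) * 1"
    by (intro mult_left_mono) (auto simp: measure_pmf.emeasure_le_1)
  finally show ?thesis by simp
qed

text \<open>The intersection of five likelihood-ratio tests, so that one acceptance set is
  improbable under all five wrong laws. The true law pays only the sum of the five failure
  probabilities.\<close>

definition likely :: "'z pmf \<Rightarrow> (wrong \<Rightarrow> real) \<Rightarrow> (wrong \<Rightarrow> 'z pmf) \<Rightarrow> 'z set" where
  "likely p c W = {z. \<forall>i. c i * pmf (W i) z < pmf p z}"

lemma prob_not_likely_le:
  "measure_pmf.prob p (- likely p c W) \<le> (\<Sum>i\<in>UNIV. measure_pmf.prob p {z. pmf p z \<le> c i * pmf (W i) z})"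
proof -
  have "- likely p c W = (\<Union>i\<in>UNIV. {z. pmf p z \<le> c i * pmf (W i) z})"
    by (simp add: likely_def set_eq_iff not_less)
  then show ?thesis by (simp only:) (intro measure_pmf.finite_measure_subadditive_finite; simp)
qed

lemma prob_map_unzip5:
  "measure_pmf.prob (map_pmf unzip5 p) {z. pmf (map_pmf unzip5 p) z \<le> c * pmf (map_pmf unzip5 q) z}
   = measure_pmf.prob p {zs. pmf p zs \<le> c * pmf q zs}"
  by (simp add: vimage_def pmf_map_inj'[OF inj_unzip5])

definition bins :: "real \<Rightarrow> nat \<Rightarrow> nat" where
  "bins u n = nat \<lceil>2 powr (n * u)\<rceil>"

text \<open>Rounding up costs at most a factor 2, because \<open>u \<ge> 0\<close> makes the
  unrounded number at least 1. The lower bound serves where the number of own bins is a divisor, the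
  upper one where the bins of the other user are searched.\<close>

lemma bins_bounds:
  assumes "u \<ge> 0"
  shows "2 powr (n * u) \<le> real (bins u n)" "real (bins u n) \<le> 2 * 2 powr (n * u)" "bins u n > 0"
proof -
  have 1: "1 \<le> 2 powr (n * u)" using assms by (intro ge_one_powr_ge_zero) auto
  show "2 powr (n * u) \<le> real (bins u n)" unfolding bins_def by (rule real_nat_ceiling_ge)
  then show "bins u n > 0" using 1 by linarith
  show "real (bins u n) \<le> 2 * 2 powr (n * u)"
    using 1 unfolding bins_def by (subst of_nat_nat) linarith+
qed

lemma two_powr_tendsto: "c < 0 \<Longrightarrow> (\<lambda>n. 2 powr (real n * c)) \<longlonglongrightarrow> 0"
proof -
  assume "c < 0"
  then have "norm (2 powr c) < 1" by (simp add: powr_less_one)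
  then have "(\<lambda>n. (2 powr c) ^ n) \<longlonglongrightarrow> 0" by (rule LIMSEQ_power_zero)
  then show ?thesis by (simp add: powr_power mult.commute)
qed

text \<open>Every block of \<open>K\<close>, typical or not, has its own independent book, so the
  encoders are defined on all source blocks. \<open>d\<close> is the value of the product pmf
  outside \<open>blocks n\<close>; as a parameter it can be exchanged along with the users.\<close>

definition random_code where
  "random_code d n u v p0 p1 q1 p2 q2 = Pi_pmf (blocks n) d (\<lambda>_. book (bins u n) (blocks n) (bins v n) (blocks n)
     (replicate_pmf n p0) (block_kernel p1) (block_kernel2 q1) (block_kernel p2) (block_kernel2 q2))"

definition messages where
  "messages n pK pS pT = do {k \<leftarrow> replicate_pmf n pK; s \<leftarrow> replicate_pmf n pS; t \<leftarrow> replicate_pmf n pT; return_pmf (k, s, t)}"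

text \<open>An average over the messages for a fixed code \<open>c\<close>. Here \<open>ch\<close>
  leads to one receiver only, and \<open>N2\<close> counts the bins of the user whom that receiver
  does not decode.\<close>

definition failure where
  "failure n M0 M1 N2 T ch pK pS pT c =
    (\<integral>\<^sup>+(k, s, t). emeasure (block_kernel2 ch (input1 (c k) s) (input2 (c k) t)) {y. decoded M0 M1 N2 T c y \<noteq> {(k, s)}}
      \<partial>messages n pK pS pT)"

definition divergence :: "'z pmf \<Rightarrow> 'z pmf \<Rightarrow> real" where
  "divergence p q = measure_pmf.expectation p (\<lambda>z. log 2 (pmf p z)) - measure_pmf.expectation p (\<lambda>z. log 2 (pmf q z))"

definition shannon :: "'z pmf \<Rightarrow> real" where
  "shannon p = - measure_pmf.expectation p (\<lambda>z. log 2 (pmf p z))"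

lemma count_bound_mono:
  fixes m :: real
  assumes "c0 \<le> C0" "c1 \<le> C1" "m \<le> M" "U \<le> N"
    "0 \<le> c0" "0 \<le> c1" "0 \<le> m" "0 < U" "0 \<le> a" "0 \<le> b" "0 \<le> c" "0 \<le> d" "0 \<le> f"
  shows "c1 * ((a + m * b) / N + c + m * d) + c0 * (c1 * (m * f))
    \<le> C1 * ((a + M * b) / U + c + M * d) + C0 * (C1 * (M * f))"
proof -
  have nn: "0 \<le> C0" "0 \<le> C1" "0 \<le> M" "0 < N" using assms by linarith+
  have "m * b \<le> M * b" "m * d \<le> M * d" "m * f \<le> M * f" using assms by (auto intro: mult_right_mono)
  moreover from this have "(a + m * b) / N \<le> (a + M * b) / U" using assms nn by (intro frac_le) auto
  moreover have "c1 * (m * f) \<le> C1 * (M * f)" using assms nn calculation by (intro mult_mono) auto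
  ultimately show ?thesis using assms nn by (intro add_mono mult_mono) auto
qed

text \<open>The exponents \<open>\<gamma> i\<close> lie below the divergences, so the true tuple
  passes with probability tending to 1. They also exceed the growth rates of the weighted numbers of
  wrong candidates, so the expected number of those that pass decays exponentially for each
  kind.\<close>

lemma failure_vanishes:
  fixes pK :: "'k::finite pmf" and pS :: "'a::finite pmf" and pT :: "'b::finite pmf"
    and p0 :: "'w0::finite pmf" and p1 :: "'w0 \<Rightarrow> 'w1::finite pmf" and q1 :: "'w0 \<Rightarrow> 'w1 \<Rightarrow> 'x1::finite pmf"
    and p2 :: "'w0 \<Rightarrow> 'w2::finite pmf" and q2 :: "'w0 \<Rightarrow> 'w2 \<Rightarrow> 'x2::finite pmf"
    and ch :: "'x1 \<Rightarrow> 'x2 \<Rightarrow> 'y::finite pmf"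
  defines "L \<equiv> true_law p0 p1 q1 p2 q2 ch" and "W \<equiv> \<lambda>i. wrong_law i p0 p1 q1 p2 q2 ch"
  assumes R: "R0 > shannon pK" "R1 > shannon pS" and uv: "u \<ge> 0" "v \<ge> 0"
    and \<gamma>: "\<And>i. \<gamma> i < divergence L (W i)"
    and rates: "R1 - u < \<gamma> (Some (True, True))" "R1 + v - u < \<gamma> (Some (True, False))"
      "R1 < \<gamma> (Some (False, True))" "R1 + v < \<gamma> (Some (False, False))" "R0 + R1 + v < \<gamma> None"
  shows "\<exists>r T. r \<longlonglongrightarrow> 0 \<and> (\<forall>n d. (\<integral>\<^sup>+c. failure n (typical R0 n pK) (typical R1 n pS) (bins v n) (T n) ch pK pS pT c
      \<partial>random_code d n u v p0 p1 q1 p2 q2) \<le> ennreal (r n))"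
proof -
  define Ln where "Ln n = map_pmf unzip5 (replicate_pmf n L)" for n
  define Wn where "Wn n i = map_pmf unzip5 (replicate_pmf n (W i))" for n i
  define T where "T n = likely (Ln n) (\<lambda>i. 2 powr (n * \<gamma> i)) (Wn n)" for n
  define atyp where "atyp n = measure_pmf.prob (Ln n) (- T n)" for n
  \<comment> \<open>The bound that \<open>emeasure_likely_le\<close> gives for a wrong candidate of
    kind \<open>i\<close> to pass.\<close>
  define g where "g n i = 2 powr (- (n * \<gamma> i))" for n :: nat and i
  define e where "e n = real (card (typical R1 n pS)) * ((g n (Some (True, True)) + bins v n * g n (Some (True, False))) / bins u n
      + g n (Some (False, True)) + bins v n * g n (Some (False, False)))
      + real (card (typical R0 n pK)) * (real (card (typical R1 n pS)) * (bins v n * g n None))" for n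
  define r where "r n = measure_pmf.prob (replicate_pmf n pK) (- typical R0 n pK)
      + measure_pmf.prob (replicate_pmf n pS) (- typical R1 n pS) + atyp n + e n" for n
  have "atyp \<longlonglongrightarrow> 0"
  proof (rule squeeze_0)
    show "atyp n \<le> (\<Sum>i\<in>UNIV. measure_pmf.prob (replicate_pmf n L)
      {zs. pmf (replicate_pmf n L) zs \<le> 2 powr (n * \<gamma> i) * pmf (replicate_pmf n (W i)) zs})" for n
      using prob_not_likely_le[of "Ln n" "\<lambda>i. 2 powr (n * \<gamma> i)" "Wn n"]
      by (simp only: atyp_def T_def Ln_def Wn_def prob_map_unzip5)
    show "(\<lambda>n. \<Sum>i\<in>UNIV. measure_pmf.prob (replicate_pmf n L)
      {zs. pmf (replicate_pmf n L) zs \<le> 2 powr (n * \<gamma> i) * pmf (replicate_pmf n (W i)) zs}) \<longlonglongrightarrow> 0"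
      using \<gamma> unfolding divergence_def L_def W_def
      by (intro tendsto_null_sum likelihood_ratio_tendsto set_true_law_subset) auto
  qed (simp add: atyp_def)
  moreover have "e \<longlonglongrightarrow> 0"
  proof (rule squeeze_0)
    let ?p = "\<lambda>n c. 2 powr (real n * c)"
    \<comment> \<open>One summand for each kind of wrong candidate; the factors 2 come from rounding
      up the number of bins of the other user.\<close>
    let ?E = "\<lambda>n. ?p n (R1 - u - \<gamma> (Some (True, True))) + 2 * ?p n (R1 + v - u - \<gamma> (Some (True, False)))
      + ?p n (R1 - \<gamma> (Some (False, True))) + 2 * ?p n (R1 + v - \<gamma> (Some (False, False)))
      + 2 * ?p n (R0 + R1 + v - \<gamma> None)"
    show "e n \<ge> 0" for n by (simp add: e_def g_def)
    show "e n \<le> ?E n" for n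
    proof -
      have "e n \<le> ?p n R1 * ((g n (Some (True, True)) + (2 * ?p n v) * g n (Some (True, False))) / ?p n u
          + g n (Some (False, True)) + (2 * ?p n v) * g n (Some (False, False)))
        + ?p n R0 * (?p n R1 * ((2 * ?p n v) * g n None))"
        unfolding e_def
        by (intro count_bound_mono bins_bounds card_typical uv) (simp_all add: g_def)
      also have "\<dots> = ?E n"
        by (simp add: g_def right_diff_distrib distrib_left powr_diff powr_add powr_minus_divide add_divide_distrib)
           (simp add: ac_simps)
      finally show ?thesis .
    qed
    show "?E \<longlonglongrightarrow> 0"
      using rates by (intro tendsto_add_zero tendsto_mult_right_zero two_powr_tendsto) auto
  qed
  ultimately have "r \<longlonglongrightarrow> 0"
    unfolding r_def using R typical_tendsto[of pK R0] typical_tendsto[of pS R1]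
    by (intro tendsto_add_zero) (auto simp: shannon_def)
  moreover have "(\<integral>\<^sup>+c. failure n (typical R0 n pK) (typical R1 n pS) (bins v n) (T n) ch pK pS pT c
      \<partial>random_code d n u v p0 p1 q1 p2 q2) \<le> ennreal (r n)" for n d
  proof -
    let ?C = "random_code d n u v p0 p1 q1 p2 q2" and ?M = "messages n pK pS pT"
    let ?Ktyp = "typical R0 n pK" and ?Styp = "typical R1 n pS"
    have wrong: "emeasure (Wn n i) (T n) \<le> ennreal (g n i)" for i
    proof -
      have "emeasure (measure_pmf (Wn n i)) (T n) \<le> ennreal (1 / 2 powr (real n * \<gamma> i))"
        by (rule emeasure_likely_le[where p = "Ln n"]) (auto simp: T_def likely_def less_imp_le)
      then show ?thesis by (simp add: g_def powr_minus_divide)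
    qed
    have "(\<integral>\<^sup>+c. emeasure (block_kernel2 ch (input1 (c k) s) (input2 (c k) t)) {y. decoded ?Ktyp ?Styp (bins v n) (T n) c y \<noteq> {(k, s)}} \<partial>?C)
      \<le> indicator (- ?Ktyp) k + indicator (- ?Styp) s + ennreal (atyp n + e n)" if "(k, s, t) \<in> set_pmf ?M" for k s t
    proof -
      let ?w = "\<lambda>i. emeasure (Wn n i) (T n)"
      have "k \<in> blocks n" "s \<in> blocks n" "t \<in> blocks n"
        using that by (auto simp: messages_def set_replicate_pmf blocks_def)
      then have "(\<integral>\<^sup>+c. emeasure (block_kernel2 ch (input1 (c k) s) (input2 (c k) t)) {y. decoded ?Ktyp ?Styp (bins v n) (T n) c y \<noteq> {(k, s)}} \<partial>?C)
        \<le> indicator (- ?Ktyp) k + indicator (- ?Styp) s + emeasure (Ln n) (- T n)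
          + of_nat (card ?Styp) * ((?w (Some (True, True)) + of_nat (bins v n) * ?w (Some (True, False))) / of_nat (bins u n)
              + ?w (Some (False, True)) + of_nat (bins v n) * ?w (Some (False, False)))
          + of_nat (card ?Ktyp) * (of_nat (card ?Styp) * (of_nat (bins v n) * ?w None))"
        \<comment> \<open>Read backwards, the block identities turn the product laws into laws built
          from block kernels, to which the decoding bound applies.\<close>
        unfolding random_code_def Ln_def Wn_def L_def W_def true_law_block[symmetric] wrong_law_block[symmetric]
        unfolding wrong_law_def option.case prod.case
        using uv by (intro decoding_error_le finite_blocks typical_subset bins_bounds)
      also have "\<dots> \<le> indicator (- ?Ktyp) k + indicator (- ?Styp) s + ennreal (atyp n)
          + of_nat (card ?Styp) * ((ennreal (g n (Some (True, True))) + of_nat (bins v n) * ennreal (g n (Some (True, False)))) / of_nat (bins u n)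
              + ennreal (g n (Some (False, True))) + of_nat (bins v n) * ennreal (g n (Some (False, False))))
          + of_nat (card ?Ktyp) * (of_nat (card ?Styp) * (of_nat (bins v n) * ennreal (g n None)))"
        unfolding atyp_def measure_pmf.emeasure_eq_measure[symmetric]
        by (intro add_mono mult_left_mono divide_right_mono_ennreal wrong order_refl) auto
      also have "\<dots> = indicator (- ?Ktyp) k + indicator (- ?Styp) s + ennreal (atyp n + e n)"
        using bins_bounds(3)[OF uv(1), of n]
        by (simp add: e_def atyp_def g_def ennreal_of_nat_eq_real_of_nat add.assoc divide_ennreal
           flip: ennreal_mult ennreal_plus)
      finally show ?thesis .
    qed
    then have "(\<integral>\<^sup>+c. failure n ?Ktyp ?Styp (bins v n) (T n) ch pK pS pT c \<partial>?C)
      \<le> (\<integral>\<^sup>+(k, s, t). indicator (- ?Ktyp) k + indicator (- ?Styp) s + ennreal (atyp n + e n) \<partial>?M)"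
      \<comment> \<open>The code is averaged first, for fixed messages, where the bound just
        obtained applies.\<close>
      unfolding failure_def
      by (subst nn_integral_pmf_commute) (intro nn_integral_mono_AE AE_pmfI, auto)
    also have "\<dots> = emeasure (replicate_pmf n pK) (- ?Ktyp) + emeasure (replicate_pmf n pS) (- ?Styp) + ennreal (atyp n + e n)"
      by (simp add: messages_def nn_integral_add)
    also have "\<dots> = ennreal (r n)"
      by (simp add: r_def measure_pmf.emeasure_eq_measure atyp_def e_def g_def add.assoc flip: ennreal_plus)
    finally show ?thesis .
  qed
  ultimately show ?thesis by blast
qed

section \<open>Exchanging the two users\<close>

definition swap_users :: "'a \<times> 'b \<times> 'c \<Rightarrow> 'a \<times> 'c \<times> 'b" where
  "swap_users = (\<lambda>(w, b1, b2). (w, b2, b1))"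

lemma input_swap [simp]: "input1 (swap_users c) s = input2 c s" "input2 (swap_users c) t = input1 c t"
  by (simp_all add: input1_def input2_def swap_users_def split: prod.split)

lemma book_swap:
  "book N2 A2 N1 A1 p0 p2 q2 p1 q1 = map_pmf swap_users (book N1 A1 N2 A2 p0 p1 q1 p2 q2)"
  unfolding book_def map_bind_pmf
  by (subst bind_commute_pmf[where B = "user_book N1 _ _ _"]) (simp add: swap_users_def)

text \<open>Both receivers must be served by one code. A random code with the users exchanged is
  distributed as the random code of the exchanged problem, so the bound for receiver 1 carries over
  to receiver 2 without a second draw.\<close>

lemma random_code_swap:
  fixes d :: "'w0 list \<times> ((nat \<Rightarrow> 'w1 list) \<times> ('a::finite list \<Rightarrow> nat \<times> 'x1 list))
      \<times> (nat \<Rightarrow> 'w2 list) \<times> ('b::finite list \<Rightarrow> nat \<times> 'x2 list)"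
  shows "(random_code (swap_users d) n v u p0 p2 q2 p1 q1 :: ('k::finite list \<Rightarrow> _) pmf) = map_pmf (\<lambda>c. swap_users \<circ> c) (random_code d n u v p0 p1 q1 p2 q2)"
  unfolding random_code_def by (subst book_swap) (rule Pi_pmf_map[OF finite_blocks refl])

lemma random_code_blocks:
  fixes k :: "'k::finite list" and s :: "'a::finite list" and t :: "'b::finite list"
  assumes "c \<in> set_pmf (random_code d n u v p0 p1 q1 p2 q2)" "u \<ge> 0" "v \<ge> 0"
    "k \<in> blocks n" "s \<in> blocks n" "t \<in> blocks n"
  shows "input1 (c k) s \<in> blocks n" "input2 (c k) t \<in> blocks n"
proof -
  have "c k \<in> set_pmf (book (bins u n) (blocks n) (bins v n) (blocks n) (replicate_pmf n p0) (block_kernel p1) (block_kernel2 q1) (block_kernel p2) (block_kernel2 q2))"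
    using assms by (auto simp: random_code_def set_Pi_pmf[OF finite_blocks] PiE_dflt_def)
  then obtain w0 b1 b2 where c: "c k = (w0, b1, b2)" and w0: "length w0 = n"
    and b1: "b1 \<in> set_pmf (user_book (bins u n) (blocks n) (block_kernel p1 w0) (block_kernel2 q1 w0))"
    and b2: "b2 \<in> set_pmf (user_book (bins v n) (blocks n) (block_kernel p2 w0) (block_kernel2 q2 w0))"
    by (auto simp: book_def set_replicate_pmf)
  note b1 = set_user_book[OF b1 finite_blocks bins_bounds(3)[OF assms(2)]]
  note b2 = set_user_book[OF b2 finite_blocks bins_bounds(3)[OF assms(3)]]
  show "input1 (c k) s \<in> blocks n"
    using b1(3)[OF assms(5), THEN set_block_kernel_length] b1(2)[OF b1(1)[OF assms(5)], THEN set_block_kernel_length] w0 c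
    by (simp add: input1_def blocks_def)
  show "input2 (c k) t \<in> blocks n"
    using b2(3)[OF assms(6), THEN set_block_kernel_length] b2(2)[OF b2(1)[OF assms(6)], THEN set_block_kernel_length] w0 c
    by (simp add: input2_def blocks_def)
qed

section \<open>From codebooks to block codes\<close>

lemma sum_cond_prob_le:
  fixes \<mu> :: "'z pmf"
  assumes "finite A"
  shows "(\<Sum>a\<in>A. pmf (map_pmf X \<mu>) a * \<P>(z in \<mu>. Q a z \<bar> X z = a)) \<le> measure_pmf.prob \<mu> {z. Q (X z) z}"
proof -
  have "pmf (map_pmf X \<mu>) a * \<P>(z in \<mu>. Q a z \<bar> X z = a) = measure_pmf.prob \<mu> {z. Q a z \<and> X z = a}" for a
  proof -
    have "measure_pmf.prob \<mu> {z. Q a z \<and> X z = a} \<le> measure_pmf.prob \<mu> {z. X z = a}"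
      by (intro measure_pmf.finite_measure_mono) auto
    moreover have "pmf (map_pmf X \<mu>) a = measure_pmf.prob \<mu> {z. X z = a}"
      by (simp add: pmf_map vimage_def)
    \<comment> \<open>If \<open>a\<close> has probability zero, the conditional probability is 0 / 0
      = 0 and both sides vanish.\<close>
    ultimately show ?thesis
      by (cases "measure_pmf.prob \<mu> {z. X z = a} = 0") (auto simp: cond_prob_def intro: antisym)
  qed
  then have "(\<Sum>a\<in>A. pmf (map_pmf X \<mu>) a * \<P>(z in \<mu>. Q a z \<bar> X z = a))
    = (\<Sum>a\<in>A. measure_pmf.prob \<mu> {z. Q a z \<and> X z = a})" by simp
  also have "\<dots> = measure_pmf.prob \<mu> (\<Union>a\<in>A. {z. Q a z \<and> X z = a})"
    using assms by (intro measure_pmf.finite_measure_finite_Union[symmetric]) (auto simp: disjoint_family_on_def)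
  also have "\<dots> \<le> measure_pmf.prob \<mu> {z. Q (X z) z}"
    by (intro measure_pmf.finite_measure_mono) auto
  finally show ?thesis .
qed

definition encoder1 where "encoder1 c sn = input1 (c (map snd sn)) (map fst sn)"
definition encoder2 where "encoder2 c tn = input2 (c (map snd tn)) (map fst tn)"
text \<open>Without a unique candidate the output is arbitrary but still of length \<open>n\<close>,
  since a decoder has to map into \<open>blocks n\<close>.\<close>

definition decoder where
  "decoder n D y = (if \<exists>ks. D y = {ks} then (case the_elem (D y) of (k, s) \<Rightarrow> zip s k) else replicate n undefined)"

definition common_source where
  "common_source pK pS pT = do {k \<leftarrow> pK; s \<leftarrow> pS; t \<leftarrow> pT; return_pmf ((s, k), (t, k))}"

lemma common_source_block:
  "replicate_pmf n (common_source pK pS pT)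
    = map_pmf (\<lambda>(k, s, t). zip (zip s k) (zip t k)) (messages n pK pS pT)"
proof -
  have "map_pmf (\<lambda>(k, s, t). zip (zip s k) (zip t k)) (messages n pK pS pT) =
    do {k \<leftarrow> replicate_pmf n pK; s \<leftarrow> replicate_pmf n pS; t \<leftarrow> replicate_pmf n pT; return_pmf (zip (zip s k) (zip t k))}"
    by (simp add: messages_def map_bind_pmf)
  also have "\<dots> = bind_pmf (replicate_pmf n (do {k \<leftarrow> pK; z \<leftarrow> do {s \<leftarrow> pS; t \<leftarrow> pT; return_pmf (s, t)}; return_pmf (k, z)}))
     (\<lambda>zs. return_pmf (map (\<lambda>(k, s, t). ((s, k), (t, k))) zs))"
    by (simp add: replicate_bind_replicate zip_maps case_prod_unfold o_def)
  also have "\<dots> = replicate_pmf n (common_source pK pS pT)"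
    unfolding map_pmf_def[symmetric] replicate_pmf_map[symmetric]
    by (simp add: common_source_def map_pmf_def bind_assoc_pmf bind_return_pmf)
  finally show ?thesis ..
qed

lemma code_law_common:
  "code_law (common_source pK pS pT) ch n (encoder1 c) (encoder2 c) =
   do {(k, s, t) \<leftarrow> messages n pK pS pT;
       map_pmf (\<lambda>y. (zip s k, zip t k, map fst y, map snd y)) (block_kernel2 ch (input1 (c k) s) (input2 (c k) t))}"
  unfolding code_law_def common_source_block bind_map_pmf block_channel_eq_block_kernel map_pmf_def[symmetric]
  by (intro bind_pmf_cong refl) (auto simp: messages_def set_replicate_pmf encoder1_def encoder2_def simp del: map_map)

lemma messages_swap: "messages n pK pT pS = map_pmf (\<lambda>(k, s, t). (k, t, s)) (messages n pK pS pT)"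
  unfolding messages_def map_bind_pmf
  by (subst bind_commute_pmf[where B = "replicate_pmf n pS"]) simp

text \<open>Receiver 1 sees only the first output component, so its error is governed by the
  marginal channel. Whenever the set of candidates is the right singleton, the decoder returns the
  source block.\<close>

lemma error_prob1_le:
  assumes "failure n M0 M1 N2 T (\<lambda>a b. map_pmf fst (ch a b)) pK pS pT c \<le> ennreal r" "r \<ge> 0"
  shows "error_prob1 (common_source pK pS pT) ch n (encoder1 c) (encoder2 c) (decoder n (decoded M0 M1 N2 T c)) \<le> r"
proof -
  let ?\<phi> = "decoder n (decoded M0 M1 N2 T c)"
  let ?\<mu> = "code_law (common_source pK pS pT) ch n (encoder1 c) (encoder2 c)"
  have marginal: "replicate_pmf n (map_pmf fst (common_source pK pS pT)) = map_pmf fst ?\<mu>"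
    unfolding replicate_pmf_map code_law_def map_bind_pmf by (simp add: map_pmf_def bind_return_pmf)
  have "error_prob1 (common_source pK pS pT) ch n (encoder1 c) (encoder2 c) ?\<phi>
    \<le> measure_pmf.prob ?\<mu> {z. fst z \<noteq> ?\<phi> (fst (snd (snd z)))}"
    using sum_cond_prob_le[OF finite_blocks, of fst ?\<mu> "\<lambda>s z. s \<noteq> ?\<phi> (fst (snd (snd z)))" n]
    by (simp add: error_prob1_def marginal case_prod_unfold)
  also have "\<dots> \<le> r"
  proof -
    have "ennreal (measure_pmf.prob ?\<mu> {z. fst z \<noteq> ?\<phi> (fst (snd (snd z)))}) = (\<integral>\<^sup>+(k, s, t). emeasure (block_kernel2 ch (input1 (c k) s) (input2 (c k) t)) {y. zip s k \<noteq> ?\<phi> (map fst y)}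
        \<partial>messages n pK pS pT)"
      unfolding measure_pmf.emeasure_eq_measure[symmetric] code_law_common
      by (simp add: case_prod_unfold vimage_def)
    also have "\<dots> \<le> failure n M0 M1 N2 T (\<lambda>a b. map_pmf fst (ch a b)) pK pS pT c"
      unfolding failure_def
    proof (intro nn_integral_mono, clarify)
      fix k s t
      have "block_kernel2 (\<lambda>a b. map_pmf fst (ch a b)) xs ys = map_pmf (map fst) (block_kernel2 ch xs ys)" for xs ys
        by (simp add: map_block_kernel case_prod_unfold)
      then show "emeasure (block_kernel2 ch (input1 (c k) s) (input2 (c k) t)) {y. zip s k \<noteq> ?\<phi> (map fst y)}
        \<le> emeasure (block_kernel2 (\<lambda>a b. map_pmf fst (ch a b)) (input1 (c k) s) (input2 (c k) t))
            {y. decoded M0 M1 N2 T c y \<noteq> {(k, s)}}"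
        by (auto simp: decoder_def intro!: emeasure_mono)
    qed
    also note assms(1)
    finally show ?thesis using assms(2) by simp
  qed
  finally show ?thesis .
qed

lemma error_prob2_le:
  assumes "failure n M0 M2 N1 T (\<lambda>b a. map_pmf snd (ch a b)) pK pT pS (swap_users \<circ> c) \<le> ennreal r" "r \<ge> 0"
  shows "error_prob2 (common_source pK pS pT) ch n (encoder1 c) (encoder2 c) (decoder n (decoded M0 M2 N1 T (swap_users \<circ> c))) \<le> r"
proof -
  let ?\<phi> = "decoder n (decoded M0 M2 N1 T (swap_users \<circ> c))"
  let ?\<mu> = "code_law (common_source pK pS pT) ch n (encoder1 c) (encoder2 c)"
  have marginal: "replicate_pmf n (map_pmf snd (common_source pK pS pT)) = map_pmf (fst \<circ> snd) ?\<mu>"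
    unfolding replicate_pmf_map code_law_def map_bind_pmf by (simp add: map_pmf_def bind_return_pmf)
  have "error_prob2 (common_source pK pS pT) ch n (encoder1 c) (encoder2 c) ?\<phi>
    \<le> measure_pmf.prob ?\<mu> {z. fst (snd z) \<noteq> ?\<phi> (snd (snd (snd z)))}"
    using sum_cond_prob_le[OF finite_blocks, of "fst \<circ> snd" ?\<mu> "\<lambda>s z. s \<noteq> ?\<phi> (snd (snd (snd z)))" n]
    by (simp add: error_prob2_def marginal case_prod_unfold)
  also have "\<dots> \<le> r"
  proof -
    have "ennreal (measure_pmf.prob ?\<mu> {z. fst (snd z) \<noteq> ?\<phi> (snd (snd (snd z)))}) = (\<integral>\<^sup>+(k, s, t). emeasure (block_kernel2 ch (input1 (c k) s) (input2 (c k) t)) {y. zip t k \<noteq> ?\<phi> (map snd y)}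
        \<partial>messages n pK pS pT)"
      unfolding measure_pmf.emeasure_eq_measure[symmetric] code_law_common
      by (simp add: case_prod_unfold vimage_def)
    also have "\<dots> \<le> failure n M0 M2 N1 T (\<lambda>b a. map_pmf snd (ch a b)) pK pT pS (swap_users \<circ> c)"
      unfolding failure_def messages_swap[of n pK pT pS] nn_integral_map_pmf
    proof (intro nn_integral_mono, clarsimp)
      fix k s t
      \<comment> \<open>Exchanging the users exchanges the two input blocks inside
        \<open>zip\<close>.\<close>
      have "block_kernel2 (\<lambda>b a. map_pmf snd (ch a b)) ys xs = map_pmf (map snd) (block_kernel2 ch xs ys)" for xs ys
        by (subst zip_commute) (simp add: map_block_kernel block_kernel_map case_prod_unfold)
      then show "emeasure (block_kernel2 ch (input1 (c k) s) (input2 (c k) t)) {y. zip t k \<noteq> ?\<phi> (map snd y)}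
        \<le> emeasure (block_kernel2 (\<lambda>b a. map_pmf snd (ch a b)) (input2 (c k) t) (input1 (c k) s))
            {y. decoded M0 M2 N1 T (swap_users \<circ> c) y \<noteq> {(k, t)}}"
        by (auto simp: decoder_def intro!: emeasure_mono)
    qed
    also note assms(1)
    finally show ?thesis using assms(2) by simp
  qed
  finally show ?thesis .
qed

lemma decoder_blocks:
  assumes "M0 \<subseteq> blocks n" "M1 \<subseteq> blocks n"
  shows "decoder n (decoded M0 M1 N2 T c) y \<in> blocks n"
proof (cases "\<exists>ks. decoded M0 M1 N2 T c y = {ks}")
  case True
  then obtain k s where ks: "decoded M0 M1 N2 T c y = {(k, s)}" by auto
  then have "k \<in> M0" "s \<in> M1" by (auto simp: decoded_def)
  then show ?thesis using ks assms by (auto simp: decoder_def blocks_def subset_iff)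
qed (simp add: decoder_def blocks_def)

lemma exists_le_nn_integral:
  assumes "(\<integral>\<^sup>+c. f c \<partial>measure_pmf p) < e"
  shows "\<exists>c\<in>set_pmf p. f c < e"
proof (rule ccontr)
  assume "\<not> ?thesis"
  then have "(\<integral>\<^sup>+c. e \<partial>measure_pmf p) \<le> (\<integral>\<^sup>+c. f c \<partial>measure_pmf p)"
    by (intro nn_integral_mono_AE AE_pmfI) (auto simp: not_less)
  then show False using assms by simp
qed

lemma admissible_common_source:
  fixes pK :: "'k::finite pmf" and pS :: "'a::finite pmf" and pT :: "'b::finite pmf"
    and p0 :: "'w0::finite pmf" and p1 :: "'w0 \<Rightarrow> 'w1::finite pmf" and q1 :: "'w0 \<Rightarrow> 'w1 \<Rightarrow> 'x1::finite pmf"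
    and p2 :: "'w0 \<Rightarrow> 'w2::finite pmf" and q2 :: "'w0 \<Rightarrow> 'w2 \<Rightarrow> 'x2::finite pmf"
    and ch :: "'x1 \<Rightarrow> 'x2 \<Rightarrow> ('y1::finite \<times> 'y2::finite) pmf"
  defines "D1 \<equiv> \<lambda>i. divergence (true_law p0 p1 q1 p2 q2 (\<lambda>a b. map_pmf fst (ch a b)))
      (wrong_law i p0 p1 q1 p2 q2 (\<lambda>a b. map_pmf fst (ch a b)))"
    and "D2 \<equiv> \<lambda>i. divergence (true_law p0 p2 q2 p1 q1 (\<lambda>b a. map_pmf snd (ch a b)))
      (wrong_law i p0 p2 q2 p1 q1 (\<lambda>b a. map_pmf snd (ch a b)))"
  assumes uv: "u \<ge> 0" "v \<ge> 0"
    and rates1: "shannon pS - u < D1 (Some (True, True))" "shannon pS + v - u < D1 (Some (True, False))"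
      "shannon pS < D1 (Some (False, True))" "shannon pS + v < D1 (Some (False, False))"
      "shannon pK + shannon pS + v < D1 None"
    and rates2: "shannon pT - v < D2 (Some (True, True))" "shannon pT + u - v < D2 (Some (True, False))"
      "shannon pT < D2 (Some (False, True))" "shannon pT + u < D2 (Some (False, False))"
      "shannon pK + shannon pT + u < D2 None"
  shows "admissible (common_source pK pS pT) ch"
proof -
  let ?ch1 = "\<lambda>a b. map_pmf fst (ch a b)" and ?ch2 = "\<lambda>b a. map_pmf snd (ch a b)"
  define gap where "gap = Min ({D1 (Some (True, True)) - (shannon pS - u), D1 (Some (True, False)) - (shannon pS + v - u),
      D1 (Some (False, True)) - shannon pS, D1 (Some (False, False)) - (shannon pS + v), D1 None - (shannon pK + shannon pS + v)}
    \<union> {D2 (Some (True, True)) - (shannon pT - v), D2 (Some (True, False)) - (shannon pT + u - v),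
      D2 (Some (False, True)) - shannon pT, D2 (Some (False, False)) - (shannon pT + u), D2 None - (shannon pK + shannon pT + u)})"
  \<comment> \<open>Source rates are raised and thresholds lowered by \<open>\<delta>\<close>. The
    inequality for a wrong block of \<open>K\<close> pays this most often, namely three times, so a
    quarter of the gap keeps all of them strict.\<close>
  define \<delta> where "\<delta> = gap / 4"
  have "gap > 0" unfolding gap_def using rates1 rates2 by (subst Min_gr_iff) auto
  then have \<delta>: "\<delta> > 0" by (simp add: \<delta>_def)
  have gap: "x \<ge> 4 * \<delta>" if "x \<in> {D1 (Some (True, True)) - (shannon pS - u), D1 (Some (True, False)) - (shannon pS + v - u),
      D1 (Some (False, True)) - shannon pS, D1 (Some (False, False)) - (shannon pS + v), D1 None - (shannon pK + shannon pS + v)}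
    \<union> {D2 (Some (True, True)) - (shannon pT - v), D2 (Some (True, False)) - (shannon pT + u - v),
      D2 (Some (False, True)) - shannon pT, D2 (Some (False, False)) - (shannon pT + u), D2 None - (shannon pK + shannon pT + u)}" for x
  proof -
    have "gap \<le> x" using that unfolding gap_def by (intro Min_le) auto
    then show ?thesis by (simp add: \<delta>_def)
  qed
  define R0 where "R0 = shannon pK + \<delta>"
  define R1 where "R1 = shannon pS + \<delta>"
  define R2 where "R2 = shannon pT + \<delta>"
  have "\<exists>r T. r \<longlonglongrightarrow> 0 \<and> (\<forall>n d. (\<integral>\<^sup>+c. failure n (typical R0 n pK) (typical R1 n pS) (bins v n) (T n) ?ch1 pK pS pT c
      \<partial>random_code d n u v p0 p1 q1 p2 q2) \<le> ennreal (r n))"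
    using \<delta> uv gap
    by (intro failure_vanishes[where \<gamma> = "\<lambda>i. D1 i - \<delta>"]) (force simp: R0_def R1_def D1_def)+
  then obtain r1 T1 where r1: "r1 \<longlonglongrightarrow> 0" and F1: "\<And>n d. (\<integral>\<^sup>+c. failure n (typical R0 n pK) (typical R1 n pS) (bins v n) (T1 n) ?ch1 pK pS pT c
      \<partial>random_code d n u v p0 p1 q1 p2 q2) \<le> ennreal (r1 n)" by blast
  have "\<exists>r T. r \<longlonglongrightarrow> 0 \<and> (\<forall>n d. (\<integral>\<^sup>+c. failure n (typical R0 n pK) (typical R2 n pT) (bins u n) (T n) ?ch2 pK pT pS c
      \<partial>random_code d n v u p0 p2 q2 p1 q1) \<le> ennreal (r n))"
    using \<delta> uv gap
    by (intro failure_vanishes[where \<gamma> = "\<lambda>i. D2 i - \<delta>"]) (force simp: R0_def R2_def D2_def)+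
  then obtain r2 T2 where r2: "r2 \<longlonglongrightarrow> 0" and F2: "\<And>n d. (\<integral>\<^sup>+c. failure n (typical R0 n pK) (typical R2 n pT) (bins u n) (T2 n) ?ch2 pK pT pS c
      \<partial>random_code d n v u p0 p2 q2 p1 q1) \<le> ennreal (r2 n)" by blast
  show ?thesis
    unfolding admissible_def
  proof
    fix \<epsilon> :: real assume "\<epsilon> \<in> {0<..<1}"
    then have "\<epsilon> > 0" by simp
    then have "\<forall>\<^sub>F n in sequentially. r1 n < \<epsilon> / 4" "\<forall>\<^sub>F n in sequentially. r2 n < \<epsilon> / 4"
      using order_tendstoD(2)[OF r1, of "\<epsilon> / 4"] order_tendstoD(2)[OF r2, of "\<epsilon> / 4"] by auto
    then show "\<forall>\<^sub>F n in sequentially. \<exists>f1 f2 \<phi>1 \<phi>2. f1 \<in> blocks n \<rightarrow> blocks n \<and> f2 \<in> blocks n \<rightarrow> blocks n \<and>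
          \<phi>1 \<in> blocks n \<rightarrow> blocks n \<and> \<phi>2 \<in> blocks n \<rightarrow> blocks n \<and>
          max (error_prob1 (common_source pK pS pT) ch n f1 f2 \<phi>1) (error_prob2 (common_source pK pS pT) ch n f1 f2 \<phi>2) \<le> \<epsilon>"
    proof eventually_elim
      case (elim n)
      let ?C = "random_code undefined n u v p0 p1 q1 p2 q2"
      let ?F1 = "\<lambda>c. failure n (typical R0 n pK) (typical R1 n pS) (bins v n) (T1 n) ?ch1 pK pS pT c"
      let ?F2 = "\<lambda>c. failure n (typical R0 n pK) (typical R2 n pT) (bins u n) (T2 n) ?ch2 pK pT pS (swap_users \<circ> c)"
      \<comment> \<open>Averaging the sum of both failures yields one code that suits both
        receivers. The total \<open>\<epsilon> / 2\<close> leaves room for the strict inequality in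
        \<open>exists_le_nn_integral\<close>.\<close>
      have "(\<integral>\<^sup>+c. ?F1 c + ?F2 c \<partial>?C) = (\<integral>\<^sup>+c. ?F1 c \<partial>?C) + (\<integral>\<^sup>+c. ?F2 c \<partial>?C)"
        by (simp add: nn_integral_add)
      also have "(\<integral>\<^sup>+c. ?F2 c \<partial>?C) \<le> ennreal (r2 n)"
        using F2[where n = n and d = "swap_users undefined"] by (simp add: random_code_swap)
      also have "(\<integral>\<^sup>+c. ?F1 c \<partial>?C) \<le> ennreal (r1 n)" by (rule F1)
      also have "ennreal (r1 n) + ennreal (r2 n) \<le> ennreal (\<epsilon> / 4) + ennreal (\<epsilon> / 4)"
        using elim by (intro add_mono ennreal_leI) auto
      also have "\<dots> = ennreal (\<epsilon> / 2)" using \<open>\<epsilon> > 0\<close> by (simp flip: ennreal_plus)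
      also have "\<dots> < ennreal \<epsilon>" using \<open>\<epsilon> > 0\<close> by (intro ennreal_lessI) auto
      finally have "(\<integral>\<^sup>+c. ?F1 c + ?F2 c \<partial>?C) < ennreal \<epsilon>" by (simp add: add_mono)
      then obtain c where c: "c \<in> set_pmf ?C" "?F1 c + ?F2 c < ennreal \<epsilon>"
        using exists_le_nn_integral by blast
      then have "?F1 c \<le> ennreal \<epsilon>" "?F2 c \<le> ennreal \<epsilon>"
        by (auto intro: order_trans[OF _ less_imp_le[OF c(2)]])
      then have "error_prob1 (common_source pK pS pT) ch n (encoder1 c) (encoder2 c)
          (decoder n (decoded (typical R0 n pK) (typical R1 n pS) (bins v n) (T1 n) c)) \<le> \<epsilon>"
        "error_prob2 (common_source pK pS pT) ch n (encoder1 c) (encoder2 c)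
          (decoder n (decoded (typical R0 n pK) (typical R2 n pT) (bins u n) (T2 n) (swap_users \<circ> c))) \<le> \<epsilon>"
        using \<open>\<epsilon> > 0\<close> by (auto intro: error_prob1_le error_prob2_le)
      moreover have "encoder1 c \<in> blocks n \<rightarrow> blocks n" "encoder2 c \<in> blocks n \<rightarrow> blocks n"
        \<comment> \<open>\<open>random_code_blocks\<close> speaks of both users at once, so the
          idle user is given a constant block.\<close>
        unfolding encoder1_def encoder2_def
        by (intro Pi_I random_code_blocks(1)[OF c(1) uv, where t = "replicate n undefined"]
              random_code_blocks(2)[OF c(1) uv, where s = "replicate n undefined"]; simp add: blocks_def)+
      moreover have "decoder n (decoded (typical R0 n pK) (typical R1 n pS) (bins v n) (T1 n) c) \<in> blocks n \<rightarrow> blocks n"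
        "decoder n (decoded (typical R0 n pK) (typical R2 n pT) (bins u n) (T2 n) (swap_users \<circ> c)) \<in> blocks n \<rightarrow> blocks n"
        by (auto intro!: decoder_blocks typical_subset)
      ultimately show ?case by (auto simp: max_def)
    qed
  qed
qed

section \<open>Entropies and divergences\<close>

text \<open>Entropies become expectations of \<open>log_lik\<close> over the common sample space, so
  identities between them reduce to pointwise identities on the support.\<close>

definition log_lik :: "'o pmf \<Rightarrow> ('o \<Rightarrow> 'a) \<Rightarrow> 'o \<Rightarrow> real" where
  "log_lik P X \<omega> = log 2 (pmf (map_pmf X P) (X \<omega>))"

lemma integrable_finite_range:
  fixes X :: "'o \<Rightarrow> 'a::finite" and f :: "'a \<Rightarrow> real"
  shows "integrable (measure_pmf P) (\<lambda>\<omega>. f (X \<omega>))"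
  using integrable_measure_pmf_finite[of "map_pmf X P" f] by simp

lemma integrable_log_lik:
  fixes X :: "'o \<Rightarrow> 'a::finite"
  shows "integrable (measure_pmf P) (log_lik P X)"
  unfolding log_lik_def by (rule integrable_finite_range)

lemma sum_range_pmf:
  fixes X :: "'o \<Rightarrow> 'a::finite" and f :: "'a \<Rightarrow> real"
  shows "(\<Sum>x\<in>range X. pmf (map_pmf X P) x * f x) = measure_pmf.expectation P (\<lambda>\<omega>. f (X \<omega>))"
proof -
  have "measure_pmf.expectation P (\<lambda>\<omega>. f (X \<omega>)) = measure_pmf.expectation (map_pmf X P) f" by simp
  also have "\<dots> = (\<Sum>x\<in>range X. f x * pmf (map_pmf X P) x)"
    by (rule integral_measure_pmf_real) auto
  finally show ?thesis by (simp add: mult.commute)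
qed

lemma entropy_bits_log_lik: "entropy_bits P X = - measure_pmf.expectation P (log_lik P X)"
  using sum_range_pmf[of X P "\<lambda>x. log 2 (pmf (map_pmf X P) x)"] by (simp add: entropy_bits_eq log_lik_def[abs_def])

lemma entropy_bits_shannon: "entropy_bits P X = shannon (map_pmf X P)"
  by (simp add: entropy_bits_log_lik shannon_def log_lik_def[abs_def])

text \<open>Entropy depends only on the partition that a variable induces on the sample space. This
  allows tuples to be reordered and regrouped.\<close>

lemma entropy_bits_cong:
  assumes "\<And>\<omega> \<omega>'. X \<omega>' = X \<omega> \<longleftrightarrow> Y \<omega>' = Y \<omega>"
  shows "entropy_bits P X = entropy_bits P Y"
proof -
  have "log_lik P X \<omega> = log_lik P Y \<omega>" for \<omega>
    using assms by (simp add: log_lik_def pmf_map vimage_def)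
  then have "log_lik P X = log_lik P Y" by (rule ext)
  then show ?thesis by (simp add: entropy_bits_log_lik)
qed

lemma pmf_map_pos: "\<omega> \<in> set_pmf P \<Longrightarrow> pmf (map_pmf X P) (X \<omega>) > 0"
  by (simp add: pmf_positive)

lemma cond_mutual_info_entropy:
  "cond_mutual_info P X Y Z = entropy_bits P (X \<triangle> Z) + entropy_bits P (Y \<triangle> Z)
     - entropy_bits P (X \<triangle> Y \<triangle> Z) - entropy_bits P Z"
proof -
  have "cond_mutual_info P X Y Z = measure_pmf.expectation P (\<lambda>\<omega>.
      log 2 (pmf (map_pmf (X \<triangle> Y \<triangle> Z) P) (X \<omega>, Y \<omega>, Z \<omega>) /
          (pmf (map_pmf (X \<triangle> Z) P) (X \<omega>, Z \<omega>) *
            (pmf (map_pmf (Y \<triangle> Z) P) (Y \<omega>, Z \<omega>) / pmf (map_pmf Z P) (Z \<omega>)))))"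
    unfolding cond_mutual_info_eq
    using sum_range_pmf[of "X \<triangle> Y \<triangle> Z" P "\<lambda>(x, y, z). log 2 (pmf (map_pmf (X \<triangle> Y \<triangle> Z) P) (x, y, z) /
          (pmf (map_pmf (X \<triangle> Z) P) (x, z) *
            (pmf (map_pmf (Y \<triangle> Z) P) (y, z) / pmf (map_pmf Z P) z)))"]
    by (simp add: case_prod_unfold)
  also have "\<dots> = measure_pmf.expectation P (\<lambda>\<omega>. log_lik P (X \<triangle> Y \<triangle> Z) \<omega> + log_lik P Z \<omega>
      - log_lik P (X \<triangle> Z) \<omega> - log_lik P (Y \<triangle> Z) \<omega>)"
  proof (intro integral_cong_AE AE_pmfI)
    fix \<omega> assume "\<omega> \<in> set_pmf P"
    note pos = pmf_map_pos[OF this]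
    show "log 2 (pmf (map_pmf (X \<triangle> Y \<triangle> Z) P) (X \<omega>, Y \<omega>, Z \<omega>) /
          (pmf (map_pmf (X \<triangle> Z) P) (X \<omega>, Z \<omega>) *
            (pmf (map_pmf (Y \<triangle> Z) P) (Y \<omega>, Z \<omega>) / pmf (map_pmf Z P) (Z \<omega>))))
      = log_lik P (X \<triangle> Y \<triangle> Z) \<omega> + log_lik P Z \<omega> - log_lik P (X \<triangle> Z) \<omega> - log_lik P (Y \<triangle> Z) \<omega>"
      using pos[of "X \<triangle> Y \<triangle> Z"] pos[of "X \<triangle> Z"] pos[of "Y \<triangle> Z"] pos[of Z]
      by (simp add: log_lik_def log_divide_pos log_mult_pos)
  qed auto
  also have "\<dots> = entropy_bits P (X \<triangle> Z) + entropy_bits P (Y \<triangle> Z) - entropy_bits P (X \<triangle> Y \<triangle> Z) - entropy_bits P Z"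
    by (simp add: entropy_bits_log_lik integrable_log_lik)
  finally show ?thesis .
qed

lemma mutual_info_entropy:
  "mutual_info P X Y = entropy_bits P X + entropy_bits P Y - entropy_bits P (X \<triangle> Y)"
proof -
  have "mutual_info P X Y = measure_pmf.expectation P (\<lambda>\<omega>.
      log 2 (pmf (map_pmf (X \<triangle> Y) P) (X \<omega>, Y \<omega>) / (pmf (map_pmf X P) (X \<omega>) * pmf (map_pmf Y P) (Y \<omega>))))"
    unfolding mutual_info_eq
    using sum_range_pmf[of "X \<triangle> Y" P "\<lambda>(x, y). log 2 (pmf (map_pmf (X \<triangle> Y) P) (x, y) /
          (pmf (map_pmf X P) x * pmf (map_pmf Y P) y))"]
    by (simp add: case_prod_unfold)
  also have "\<dots> = measure_pmf.expectation P (\<lambda>\<omega>. log_lik P (X \<triangle> Y) \<omega> - log_lik P X \<omega> - log_lik P Y \<omega>)"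
  proof (intro integral_cong_AE AE_pmfI)
    fix \<omega> assume "\<omega> \<in> set_pmf P"
    note pos = pmf_map_pos[OF this]
    show "log 2 (pmf (map_pmf (X \<triangle> Y) P) (X \<omega>, Y \<omega>) / (pmf (map_pmf X P) (X \<omega>) * pmf (map_pmf Y P) (Y \<omega>)))
      = log_lik P (X \<triangle> Y) \<omega> - log_lik P X \<omega> - log_lik P Y \<omega>"
      using pos[of "X \<triangle> Y"] pos[of X] pos[of Y]
      by (simp add: log_lik_def log_divide_pos log_mult_pos)
  qed auto
  also have "\<dots> = entropy_bits P X + entropy_bits P Y - entropy_bits P (X \<triangle> Y)"
    by (simp add: entropy_bits_log_lik integrable_log_lik)
  finally show ?thesis .
qed

lemma cond_mutual_info_nonneg: "cond_mutual_info P X Y Z \<ge> 0"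
proof -
  interpret information_space "measure_pmf P" 2 by (rule information_space_measure_pmf)
  show ?thesis
    using conditional_mutual_information_nonneg[of X Y Z]
    by (simp add: cond_mutual_info_def simple_function_def)
qed

text \<open>Nonnegativity of conditional mutual information, the one information inequality behind
  the comparison of divergences with informations.\<close>

lemma submodular:
  "entropy_bits P (X \<triangle> Y \<triangle> Z) + entropy_bits P Z \<le> entropy_bits P (X \<triangle> Z) + entropy_bits P (Y \<triangle> Z)"
  using cond_mutual_info_nonneg[of P X Y Z] by (simp add: cond_mutual_info_entropy)

section \<open>Point masses of iterated draws\<close>

text \<open>The mass of a tuple is computed as an iterated integral: its indicator splits into a
  product over the entries, and integrating the indicator of an entry picks out the mass of that
  entry.\<close>

lemma ennreal_pmf_eq: "ennreal (pmf p z) = (\<integral>\<^sup>+x. indicator {z} x \<partial>p)"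
  by (simp add: emeasure_pmf_single)

lemma indicator_Pair: "(indicator {(a, b)} (x, y) :: ennreal) = indicator {a} x * indicator {b} y"
  by (auto simp: indicator_def)

lemma nn_integral_pick: "(\<integral>\<^sup>+x. indicator {a} x * f x \<partial>measure_pmf p) = ennreal (pmf p a) * f a"
proof -
  have "(\<integral>\<^sup>+x. indicator {a} x * f x \<partial>p) = (\<integral>\<^sup>+x. f a * indicator {a} x \<partial>p)"
    by (intro nn_integral_cong) (auto simp: indicator_def)
  then show ?thesis by (simp add: nn_integral_cmult emeasure_pmf_single mult.commute)
qed

lemma nn_integral_pick1: "(\<integral>\<^sup>+x. indicator {a} x \<partial>measure_pmf p) = ennreal (pmf p a)"
  by (simp add: emeasure_pmf_single)

lemma nn_integral_pick_nested:
  "(\<integral>\<^sup>+x. g x * indicator {a} x \<partial>measure_pmf p) = ennreal (pmf p a) * g a"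
  "(\<integral>\<^sup>+x. g x * (indicator {a} x * f x) \<partial>measure_pmf p) = ennreal (pmf p a) * (g a * f a)"
  "(\<integral>\<^sup>+x. g x * (h x * indicator {a} x) \<partial>measure_pmf p) = ennreal (pmf p a) * (g a * h a)"
  "(\<integral>\<^sup>+x. g x * (h x * (indicator {a} x * f x)) \<partial>measure_pmf p) = ennreal (pmf p a) * (g a * (h a * f a))"
  "(\<integral>\<^sup>+x. g x * (h x * (k x * (indicator {a} x * f x))) \<partial>measure_pmf p) = ennreal (pmf p a) * (g a * (h a * (k a * f a)))"
  using nn_integral_pick[where a = a and p = p and f = g] nn_integral_pick[where a = a and p = p and f = "\<lambda>x. g x * f x"]
    nn_integral_pick[where a = a and p = p and f = "\<lambda>x. g x * h x"] nn_integral_pick[where a = a and p = p and f = "\<lambda>x. g x * (h x * f x)"]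
    nn_integral_pick[where a = a and p = p and f = "\<lambda>x. g x * (h x * (k x * f x))"]
  by (simp_all add: mult_ac del: nn_integral_indicator)

lemmas law_pmf_simps = indicator_Pair nn_integral_pick nn_integral_pick1 nn_integral_pick_nested
  ennreal_mult nn_integral_cmult nn_integral_multc mult_ac

lemmas law_unfold = ennreal_mult pmf_nonneg mult_nonneg_nonneg ennreal_pmf_eq[of "map_pmf _ _"]
  ennreal_pmf_eq[of "mixed_law _ _ _ _ _ _ _ _"] ennreal_pmf_eq[of "fresh_law _ _ _ _ _ _"]
lemmas law_bind = true_law_def mixed_law_def fresh_law_def bind_return_pmf

lemma pmf_ennreal_eqI: "0 \<le> r \<Longrightarrow> ennreal (pmf p z) = ennreal r \<Longrightarrow> pmf p z = r"
  by simp

context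
  fixes p0 :: "'w0 pmf" and p1 :: "'w0 \<Rightarrow> 'w1 pmf" and q1 :: "'w0 \<Rightarrow> 'w1 \<Rightarrow> 'x1 pmf"
    and p2 :: "'w0 \<Rightarrow> 'w2 pmf" and q2 :: "'w0 \<Rightarrow> 'w2 \<Rightarrow> 'x2 pmf" and ch :: "'x1 \<Rightarrow> 'x2 \<Rightarrow> 'y pmf"
begin

private abbreviation (input) "L \<equiv> true_law p0 p1 q1 p2 q2 ch"
private abbreviation (input) "M b1 b2 \<equiv> mixed_law b1 b2 p0 p1 q1 p2 q2 ch"

text \<open>As simp rules these would turn integrals of indicators into measures before the point
  masses can be picked out.\<close>

declare nn_integral_indicator [simp del] nn_integral_indicator_singleton [simp del]

lemma pmf_marginals:
  "pmf (map_pmf (\<lambda>(w0, w1, x1, w2, y). w0) L) a = pmf p0 a"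
  "pmf (map_pmf (\<lambda>(w0, w1, x1, w2, y). (w0, w1)) L) (a, b) = pmf p0 a * pmf (p1 a) b"
  "pmf (map_pmf (\<lambda>(w0, w1, x1, w2, y). (w0, w2)) L) (a, d) = pmf p0 a * pmf (p2 a) d"
  "pmf (map_pmf (\<lambda>(w0, w1, x1, w2, y). (w0, w1, x1)) L) (a, b, c) = pmf p0 a * pmf (p1 a) b * pmf (q1 a b) c"
  "pmf (map_pmf (\<lambda>(w0, w1, x1, w2, y). (w0, w1, w2)) L) (a, b, d) = pmf p0 a * pmf (p1 a) b * pmf (p2 a) d"
  "pmf (map_pmf (\<lambda>(w0, w1, x1, w2, y). (w0, w1, x1, w2)) L) (a, b, c, d)
    = pmf p0 a * pmf (p1 a) b * pmf (q1 a b) c * pmf (p2 a) d"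
  by (rule pmf_ennreal_eqI, simp, simp only: law_unfold, simp add: law_bind,
      (simp only: indicator_Pair)?, simp add: law_pmf_simps)+

text \<open>The right part of a candidate keeps its true joint law with the output, a marginal of
  \<open>L\<close>; the wrong part is redrawn from the kernels.\<close>

lemma pmf_mixed_law:
  "pmf (M True True) (a, b, c, d, e)
    = pmf (map_pmf (\<lambda>(w0, w1, x1, w2, y). (w0, w1, w2, y)) L) (a, b, d, e) * pmf (q1 a b) c"
  "pmf (M True False) (a, b, c, d, e)
    = pmf (map_pmf (\<lambda>(w0, w1, x1, w2, y). (w0, w1, y)) L) (a, b, e) * (pmf (q1 a b) c * pmf (p2 a) d)"
  "pmf (M False True) (a, b, c, d, e)
    = pmf (map_pmf (\<lambda>(w0, w1, x1, w2, y). (w0, w2, y)) L) (a, d, e) * (pmf (p1 a) b * pmf (q1 a b) c)"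
  "pmf (M False False) (a, b, c, d, e)
    = pmf (map_pmf (\<lambda>(w0, w1, x1, w2, y). (w0, y)) L) (a, e) * (pmf (p1 a) b * pmf (q1 a b) c * pmf (p2 a) d)"
  by (rule pmf_ennreal_eqI, simp, simp only: law_unfold, simp add: law_bind,
      (simp only: indicator_Pair)?, simp add: law_pmf_simps)+

lemma pmf_fresh_law:
  "pmf (fresh_law p0 p1 q1 p2 q2 ch) (a, b, c, d, e)
    = pmf (map_pmf (\<lambda>(w0, w1, x1, w2, y). y) L) e * (pmf p0 a * pmf (p1 a) b * pmf (q1 a b) c * pmf (p2 a) d)"
  by (rule pmf_ennreal_eqI, simp, simp only: law_unfold, simp add: law_bind,
      (simp only: indicator_Pair)?, simp add: law_pmf_simps)

end

declare nn_integral_indicator [simp] nn_integral_indicator_singleton [simp]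

context
  fixes P :: "'o pmf"
    and W0 :: "'o \<Rightarrow> 'w0::finite" and W1 :: "'o \<Rightarrow> 'w1::finite" and W2 :: "'o \<Rightarrow> 'w2::finite"
    and X1 :: "'o \<Rightarrow> 'x1::finite" and Y :: "'o \<Rightarrow> 'y::finite"
    and p0 p1 q1 p2 and q2 :: "'w0 \<Rightarrow> 'w2 \<Rightarrow> 'x2 pmf" and ch
  assumes law: "map_pmf (\<lambda>\<omega>. (W0 \<omega>, W1 \<omega>, X1 \<omega>, W2 \<omega>, Y \<omega>)) P = true_law p0 p1 q1 p2 q2 ch"
begin

private abbreviation (input) "D i \<equiv> divergence (true_law p0 p1 q1 p2 q2 ch) (wrong_law i p0 p1 q1 p2 q2 ch)"
private abbreviation (input) "H \<equiv> entropy_bits P"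
private abbreviation (input) "V \<equiv> \<lambda>\<omega>. (W0 \<omega>, W1 \<omega>, X1 \<omega>, W2 \<omega>, Y \<omega>)"

lemma marginal_law: "map_pmf f (true_law p0 p1 q1 p2 q2 ch) = map_pmf (\<lambda>\<omega>. f (V \<omega>)) P"
  by (simp add: law[symmetric] map_pmf_comp)

text \<open>The marginals of \<open>true_law\<close> are products of its kernels, and on the support
  all factors are positive. The two identities without kernels express that \<open>W2\<close> is
  independent of \<open>W1\<close> and \<open>X1\<close> given \<open>W0\<close>.\<close>

lemma log_lik_kernels:
  assumes "\<omega> \<in> set_pmf P"
  shows "log 2 (pmf p0 (W0 \<omega>)) = log_lik P W0 \<omega>"
    "log 2 (pmf (p1 (W0 \<omega>)) (W1 \<omega>)) = log_lik P (W0 \<triangle> W1) \<omega> - log_lik P W0 \<omega>"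
    "log 2 (pmf (p2 (W0 \<omega>)) (W2 \<omega>)) = log_lik P (W0 \<triangle> W2) \<omega> - log_lik P W0 \<omega>"
    "log 2 (pmf (q1 (W0 \<omega>) (W1 \<omega>)) (X1 \<omega>)) = log_lik P (W0 \<triangle> W1 \<triangle> X1) \<omega> - log_lik P (W0 \<triangle> W1) \<omega>"
    "log_lik P (W0 \<triangle> W1 \<triangle> W2) \<omega> = log_lik P (W0 \<triangle> W1) \<omega> + log_lik P (W0 \<triangle> W2) \<omega> - log_lik P W0 \<omega>"
    "log_lik P (W0 \<triangle> W1 \<triangle> X1 \<triangle> W2) \<omega> = log_lik P (W0 \<triangle> W1 \<triangle> X1) \<omega> + log_lik P (W0 \<triangle> W2) \<omega> - log_lik P W0 \<omega>"
    and kernels_pos: "pmf p0 (W0 \<omega>) > 0" "pmf (p1 (W0 \<omega>)) (W1 \<omega>) > 0" "pmf (p2 (W0 \<omega>)) (W2 \<omega>) > 0"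
      "pmf (q1 (W0 \<omega>) (W1 \<omega>)) (X1 \<omega>) > 0"
proof -
  note m = pmf_marginals[where ?p0.0 = p0 and ?p1.0 = p1 and ?q1.0 = q1 and ?p2.0 = p2 and ?q2.0 = q2 and ch = ch, unfolded marginal_law prod.case]
  have "pmf (map_pmf (W0 \<triangle> W1 \<triangle> X1 \<triangle> W2) P) (W0 \<omega>, W1 \<omega>, X1 \<omega>, W2 \<omega>) > 0"
    by (rule pmf_map_pos[OF assms, of "W0 \<triangle> W1 \<triangle> X1 \<triangle> W2"])
  then show pos: "pmf p0 (W0 \<omega>) > 0" "pmf (p1 (W0 \<omega>)) (W1 \<omega>) > 0" "pmf (p2 (W0 \<omega>)) (W2 \<omega>) > 0"
      "pmf (q1 (W0 \<omega>) (W1 \<omega>)) (X1 \<omega>) > 0"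
    by (auto simp: m less_le)
  show "log 2 (pmf p0 (W0 \<omega>)) = log_lik P W0 \<omega>"
    "log 2 (pmf (p1 (W0 \<omega>)) (W1 \<omega>)) = log_lik P (W0 \<triangle> W1) \<omega> - log_lik P W0 \<omega>"
    "log 2 (pmf (p2 (W0 \<omega>)) (W2 \<omega>)) = log_lik P (W0 \<triangle> W2) \<omega> - log_lik P W0 \<omega>"
    "log 2 (pmf (q1 (W0 \<omega>) (W1 \<omega>)) (X1 \<omega>)) = log_lik P (W0 \<triangle> W1 \<triangle> X1) \<omega> - log_lik P (W0 \<triangle> W1) \<omega>"
    "log_lik P (W0 \<triangle> W1 \<triangle> W2) \<omega> = log_lik P (W0 \<triangle> W1) \<omega> + log_lik P (W0 \<triangle> W2) \<omega> - log_lik P W0 \<omega>"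
    "log_lik P (W0 \<triangle> W1 \<triangle> X1 \<triangle> W2) \<omega> = log_lik P (W0 \<triangle> W1 \<triangle> X1) \<omega> + log_lik P (W0 \<triangle> W2) \<omega> - log_lik P W0 \<omega>"
    using pos by (simp_all add: log_lik_def m log_mult_pos)
qed

lemma entropy_conditionally_independent:
  "H (W0 \<triangle> W1 \<triangle> W2) = H (W0 \<triangle> W1) + H (W0 \<triangle> W2) - H W0"
  "H (W0 \<triangle> W1 \<triangle> X1 \<triangle> W2) = H (W0 \<triangle> W1 \<triangle> X1) + H (W0 \<triangle> W2) - H W0"
proof -
  have "measure_pmf.expectation P (log_lik P (W0 \<triangle> W1 \<triangle> W2))
    = measure_pmf.expectation P (\<lambda>\<omega>. log_lik P (W0 \<triangle> W1) \<omega> + log_lik P (W0 \<triangle> W2) \<omega> - log_lik P W0 \<omega>)"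
    by (intro integral_cong_AE AE_pmfI log_lik_kernels) auto
  then show "H (W0 \<triangle> W1 \<triangle> W2) = H (W0 \<triangle> W1) + H (W0 \<triangle> W2) - H W0"
    by (simp add: entropy_bits_log_lik integrable_log_lik)
  have "measure_pmf.expectation P (log_lik P (W0 \<triangle> W1 \<triangle> X1 \<triangle> W2))
    = measure_pmf.expectation P (\<lambda>\<omega>. log_lik P (W0 \<triangle> W1 \<triangle> X1) \<omega> + log_lik P (W0 \<triangle> W2) \<omega> - log_lik P W0 \<omega>)"
    by (intro integral_cong_AE AE_pmfI log_lik_kernels) auto
  then show "H (W0 \<triangle> W1 \<triangle> X1 \<triangle> W2) = H (W0 \<triangle> W1 \<triangle> X1) + H (W0 \<triangle> W2) - H W0"
    by (simp add: entropy_bits_log_lik integrable_log_lik)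
qed

lemma divergence_eq:
  assumes "\<And>\<omega>. \<omega> \<in> set_pmf P \<Longrightarrow> log 2 (pmf Q (V \<omega>)) = f \<omega>"
  shows "divergence (true_law p0 p1 q1 p2 q2 ch) Q = - H V - measure_pmf.expectation P f"
proof -
  have "measure_pmf.expectation P (\<lambda>\<omega>. log 2 (pmf Q (V \<omega>))) = measure_pmf.expectation P (\<lambda>\<omega>. f \<omega>)"
    using assms by (intro integral_cong_AE AE_pmfI) auto
  then show ?thesis
    unfolding divergence_def law[symmetric] integral_map_pmf
    by (simp add: entropy_bits_log_lik log_lik_def[abs_def])
qed

text \<open>Each wrong law is a marginal of the true law times kernels, so the expectation of its
  logarithm is a signed sum of entropies.\<close>

lemma divergences:
  "D (Some (True, True)) = H (W0 \<triangle> W1 \<triangle> W2 \<triangle> Y) + H (W0 \<triangle> W1 \<triangle> X1) - H (W0 \<triangle> W1) - H V"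
  "D (Some (True, False)) = H (W0 \<triangle> W1 \<triangle> Y) + H (W0 \<triangle> W1 \<triangle> X1) - H (W0 \<triangle> W1) + H (W0 \<triangle> W2) - H W0 - H V"
  "D (Some (False, True)) = H (W0 \<triangle> W2 \<triangle> Y) + H (W0 \<triangle> W1 \<triangle> X1) - H W0 - H V"
  "D (Some (False, False)) = H (W0 \<triangle> Y) + H (W0 \<triangle> W1 \<triangle> X1) - H W0 + H (W0 \<triangle> W2) - H W0 - H V"
  "D None = H Y + H (W0 \<triangle> W1 \<triangle> X1) + H (W0 \<triangle> W2) - H W0 - H V"
proof -
  note pmfs = wrong_law_def pmf_mixed_law pmf_fresh_law marginal_law
  note pos = kernels_pos pmf_map_pos[of _ P "W0 \<triangle> W1 \<triangle> W2 \<triangle> Y"] pmf_map_pos[of _ P "W0 \<triangle> W1 \<triangle> Y"]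
    pmf_map_pos[of _ P "W0 \<triangle> W2 \<triangle> Y"] pmf_map_pos[of _ P "W0 \<triangle> Y"] pmf_map_pos[of _ P Y]
  have "D (Some (True, True)) = - H V - measure_pmf.expectation P (\<lambda>\<omega>. log_lik P (W0 \<triangle> W1 \<triangle> W2 \<triangle> Y) \<omega>
      + (log_lik P (W0 \<triangle> W1 \<triangle> X1) \<omega> - log_lik P (W0 \<triangle> W1) \<omega>))"
    by (rule divergence_eq) (simp add: pmfs pos log_mult_pos log_lik_kernels, simp add: log_lik_def)
  then show "D (Some (True, True)) = H (W0 \<triangle> W1 \<triangle> W2 \<triangle> Y) + H (W0 \<triangle> W1 \<triangle> X1) - H (W0 \<triangle> W1) - H V"
    by (simp add: entropy_bits_log_lik integrable_log_lik)
  have "D (Some (True, False)) = - H V - measure_pmf.expectation P (\<lambda>\<omega>. log_lik P (W0 \<triangle> W1 \<triangle> Y) \<omega>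
      + (log_lik P (W0 \<triangle> W1 \<triangle> X1) \<omega> - log_lik P (W0 \<triangle> W1) \<omega> + (log_lik P (W0 \<triangle> W2) \<omega> - log_lik P W0 \<omega>)))"
    by (rule divergence_eq) (simp add: pmfs pos log_mult_pos log_lik_kernels, simp add: log_lik_def)
  then show "D (Some (True, False)) = H (W0 \<triangle> W1 \<triangle> Y) + H (W0 \<triangle> W1 \<triangle> X1) - H (W0 \<triangle> W1) + H (W0 \<triangle> W2) - H W0 - H V"
    by (simp add: entropy_bits_log_lik integrable_log_lik)
  have "D (Some (False, True)) = - H V - measure_pmf.expectation P (\<lambda>\<omega>. log_lik P (W0 \<triangle> W2 \<triangle> Y) \<omega>
      + (log_lik P (W0 \<triangle> W1 \<triangle> X1) \<omega> - log_lik P W0 \<omega>))"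
    by (rule divergence_eq) (simp add: pmfs pos log_mult_pos log_lik_kernels, simp add: log_lik_def)
  then show "D (Some (False, True)) = H (W0 \<triangle> W2 \<triangle> Y) + H (W0 \<triangle> W1 \<triangle> X1) - H W0 - H V"
    by (simp add: entropy_bits_log_lik integrable_log_lik)
  have "D (Some (False, False)) = - H V - measure_pmf.expectation P (\<lambda>\<omega>. log_lik P (W0 \<triangle> Y) \<omega>
      + (log_lik P (W0 \<triangle> W1 \<triangle> X1) \<omega> - log_lik P W0 \<omega> + (log_lik P (W0 \<triangle> W2) \<omega> - log_lik P W0 \<omega>)))"
    by (rule divergence_eq) (simp add: pmfs pos log_mult_pos log_lik_kernels, simp add: log_lik_def)
  then show "D (Some (False, False)) = H (W0 \<triangle> Y) + H (W0 \<triangle> W1 \<triangle> X1) - H W0 + H (W0 \<triangle> W2) - H W0 - H V"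
    by (simp add: entropy_bits_log_lik integrable_log_lik)
  have "D None = - H V - measure_pmf.expectation P (\<lambda>\<omega>. log_lik P Y \<omega>
      + (log_lik P (W0 \<triangle> W1 \<triangle> X1) \<omega> + (log_lik P (W0 \<triangle> W2) \<omega> - log_lik P W0 \<omega>)))"
    by (rule divergence_eq) (simp add: pmfs pos log_mult_pos log_lik_kernels, simp add: log_lik_def)
  then show "D None = H Y + H (W0 \<triangle> W1 \<triangle> X1) + H (W0 \<triangle> W2) - H W0 - H V"
    by (simp add: entropy_bits_log_lik integrable_log_lik)
qed

text \<open>By conditional independence the divergences equal I(X1;Y|W0 W1 W2), I(W2 X1;Y|W0 W1),
  I(W1 X1;Y|W0 W2), I(W1 W2 X1;Y|W0) and I(W0 W1 W2 X1;Y). The first two agree with the informations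
  on the left, and the other three exceed them by I(W1;Y|X1 W0 W2). The differences in the last two
  lines are I(W2;Y|W0 W1) and I(W2;Y|W0); these lines become \<open>mono\<close> in
  \<open>fourier_motzkin\<close>.\<close>

lemma information_le_divergences:
  "cond_mutual_info P X1 Y (W0 \<triangle> W1 \<triangle> W2) \<le> D (Some (True, True))"
  "cond_mutual_info P (W2 \<triangle> X1) Y (W0 \<triangle> W1) \<le> D (Some (True, False))"
  "cond_mutual_info P X1 Y (W0 \<triangle> W2) \<le> D (Some (False, True))"
  "cond_mutual_info P (W2 \<triangle> X1) Y W0 \<le> D (Some (False, False))"
  "mutual_info P (W0 \<triangle> W2 \<triangle> X1) Y \<le> D None"
  "D (Some (True, True)) \<le> D (Some (True, False))"
  "D (Some (False, True)) \<le> D (Some (False, False))"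
proof -
  note ci = entropy_conditionally_independent
  have V: "H (X1 \<triangle> Y \<triangle> W0 \<triangle> W1 \<triangle> W2) = H V" "H ((W2 \<triangle> X1) \<triangle> Y \<triangle> W0 \<triangle> W1) = H V"
    "H (W1 \<triangle> Y \<triangle> X1 \<triangle> W0 \<triangle> W2) = H V"
    by (rule entropy_bits_cong; auto)+
  have W: "H (X1 \<triangle> W0 \<triangle> W1 \<triangle> W2) = H (W0 \<triangle> W1 \<triangle> X1 \<triangle> W2)"
    "H ((W2 \<triangle> X1) \<triangle> W0 \<triangle> W1) = H (W0 \<triangle> W1 \<triangle> X1 \<triangle> W2)"
    "H (W1 \<triangle> X1 \<triangle> W0 \<triangle> W2) = H (W0 \<triangle> W1 \<triangle> X1 \<triangle> W2)"
    by (rule entropy_bits_cong; auto)+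
  have Yp: "H (Y \<triangle> W0 \<triangle> W1 \<triangle> W2) = H (W0 \<triangle> W1 \<triangle> W2 \<triangle> Y)" "H (Y \<triangle> W0 \<triangle> W1) = H (W0 \<triangle> W1 \<triangle> Y)"
    "H (Y \<triangle> W0 \<triangle> W2) = H (W0 \<triangle> W2 \<triangle> Y)" "H (Y \<triangle> W0) = H (W0 \<triangle> Y)"
    "H (W2 \<triangle> Y \<triangle> W0 \<triangle> W1) = H (W0 \<triangle> W1 \<triangle> W2 \<triangle> Y)" "H (W2 \<triangle> W0 \<triangle> W1) = H (W0 \<triangle> W1 \<triangle> W2)"
    "H (W2 \<triangle> Y \<triangle> W0) = H (W0 \<triangle> W2 \<triangle> Y)" "H (W2 \<triangle> W0) = H (W0 \<triangle> W2)"
    by (rule entropy_bits_cong; auto)+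
  have Xp: "H (X1 \<triangle> Y \<triangle> W0 \<triangle> W2) = H (Y \<triangle> X1 \<triangle> W0 \<triangle> W2)" "H ((W2 \<triangle> X1) \<triangle> Y \<triangle> W0) = H (Y \<triangle> X1 \<triangle> W0 \<triangle> W2)"
    "H ((W0 \<triangle> W2 \<triangle> X1) \<triangle> Y) = H (Y \<triangle> X1 \<triangle> W0 \<triangle> W2)"
    "H (W0 \<triangle> W2 \<triangle> X1) = H (X1 \<triangle> W0 \<triangle> W2)" "H ((W2 \<triangle> X1) \<triangle> W0) = H (X1 \<triangle> W0 \<triangle> W2)"
    by (rule entropy_bits_cong; auto)+
  note sub = submodular[of P W1 Y "X1 \<triangle> W0 \<triangle> W2"] submodular[of P W2 Y "W0 \<triangle> W1"] submodular[of P W2 Y W0]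
  note all = cond_mutual_info_entropy mutual_info_entropy divergences V W Yp Xp
  show "cond_mutual_info P X1 Y (W0 \<triangle> W1 \<triangle> W2) \<le> D (Some (True, True))"
    "cond_mutual_info P (W2 \<triangle> X1) Y (W0 \<triangle> W1) \<le> D (Some (True, False))"
    "cond_mutual_info P X1 Y (W0 \<triangle> W2) \<le> D (Some (False, True))"
    "cond_mutual_info P (W2 \<triangle> X1) Y W0 \<le> D (Some (False, False))"
    "mutual_info P (W0 \<triangle> W2 \<triangle> X1) Y \<le> D None"
    "D (Some (True, True)) \<le> D (Some (True, False))"
    "D (Some (False, True)) \<le> D (Some (False, False))"
    using ci sub unfolding all by linarith+
qed

end

section \<open>Elimination of the bin rates\<close>

lemma exists_between_finite:
  fixes A B :: "real set"
  assumes "finite A" "A \<noteq> {}" "finite B" "B \<noteq> {}" "\<And>a b. a \<in> A \<Longrightarrow> b \<in> B \<Longrightarrow> a < b"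
  shows "\<exists>x. (\<forall>a\<in>A. a < x) \<and> (\<forall>b\<in>B. x < b)"
proof -
  have "Max A < Min B" using assms by (intro assms(5) Max_in Min_in)
  then obtain x where "Max A < x" "x < Min B" using dense by blast
  then show ?thesis using assms by auto
qed

text \<open>For each receiver \<open>a\<close>, \<open>e\<close>, \<open>d\<close>,
  \<open>g\<close>, \<open>h\<close> bound the cases \<open>Some (True, True)\<close>,
  \<open>Some (True, False)\<close>, \<open>Some (False, True)\<close>,
  \<open>Some (False, False)\<close>, \<open>None\<close>. Through \<open>mono\<close> the
  hypotheses also cover pairs of bounds without an inequality of their own, such as
  \<open>R1 + R2 < g1 + e2\<close>.\<close>

lemma fourier_motzkin:
  fixes R0 R1 R2 a1 d1 e1 g1 h1 a2 d2 e2 g2 h2 :: real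
  assumes mono: "a1 \<le> e1" "d1 \<le> g1" "a2 \<le> e2" "d2 \<le> g2"
    and "R1 < d1" "R2 < d2" "R0 + R1 < h1" "R0 + R2 < h2"
    and "R1 + R2 < a1 + g2" "R1 + R2 < a2 + g1" "R1 + R2 < e1 + e2"
    and "R0 + R1 + R2 < h2 + a1" "R0 + R1 + R2 < h1 + a2"
    and "2 * R1 + R2 < a1 + g1 + e2" "R1 + 2 * R2 < a2 + g2 + e1"
    and "R0 + 2 * R1 + R2 < a1 + h1 + e2" "R0 + R1 + 2 * R2 < a2 + h2 + e1"
  shows "\<exists>u v. 0 \<le> u \<and> 0 \<le> v \<and> R1 - u < a1 \<and> R1 + v - u < e1 \<and> R1 + v < g1 \<and> R0 + R1 + v < h1
    \<and> R2 - v < a2 \<and> R2 + u - v < e2 \<and> R2 + u < g2 \<and> R0 + R2 + u < h2"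
proof -
  \<comment> \<open>These are the bounds on \<open>u\<close> left by eliminating \<open>v\<close>:
    \<open>R1 + R2 - a2 - e1\<close> comes from \<open>R2 - a2 < v < e1 - R1 + u\<close>, and
    \<open>g1 + e2 - R1 - R2\<close> from \<open>R2 + u - e2 < v < g1 - R1\<close>. Comparing these
    two asks for a bound on \<open>2 * R1 + 2 * R2\<close>, which is the sum of two
    hypotheses.\<close>
  have "\<exists>u. (\<forall>l\<in>{0, R1 - a1, R1 - e1, R1 + R2 - a2 - e1}. l < u)
    \<and> (\<forall>r\<in>{g2 - R2, h2 - R0 - R2, g1 + e2 - R1 - R2, h1 + e2 - R0 - R1 - R2}. u < r)"
    using assms by (intro exists_between_finite) auto
  then obtain u where u: "0 < u" "R1 - a1 < u" "R1 - e1 < u" "R1 + R2 - a2 - e1 < u"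
    "u < g2 - R2" "u < h2 - R0 - R2" "u < g1 + e2 - R1 - R2" "u < h1 + e2 - R0 - R1 - R2" by auto
  have "\<exists>v. (\<forall>l\<in>{0, R2 - a2, R2 + u - e2}. l < v) \<and> (\<forall>r\<in>{g1 - R1, h1 - R0 - R1, e1 - R1 + u}. v < r)"
    using assms u by (intro exists_between_finite) auto
  then obtain v where "0 < v" "R2 - a2 < v" "R2 + u - e2 < v" "v < g1 - R1" "v < h1 - R0 - R1" "v < e1 - R1 + u" by auto
  with u show ?thesis by (intro exI[of _ u] exI[of _ v]) auto
qed

section \<open>Conditional kernels of random variables\<close>

text \<open>Where \<open>Z = z\<close> has probability zero there is nothing to condition on; such
  values carry no weight in the laws composed from this kernel, so any default will do.\<close>

definition cond_kernel :: "'o pmf \<Rightarrow> ('o \<Rightarrow> 'a) \<Rightarrow> ('o \<Rightarrow> 'c) \<Rightarrow> 'c \<Rightarrow> 'a pmf" where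
  "cond_kernel P X Z z = (if set_pmf P \<inter> {\<omega>. Z \<omega> = z} = {} then return_pmf undefined
     else map_pmf X (cond_pmf P {\<omega>. Z \<omega> = z}))"

lemma pmf_cond_kernel:
  fixes P :: "'o pmf"
  assumes "\<P>(\<omega> in P. Z \<omega> = z) \<noteq> 0"
  shows "pmf (cond_kernel P X Z z) x = \<P>(\<omega> in P. X \<omega> = x \<bar> Z \<omega> = z)"
proof -
  have ne: "set_pmf P \<inter> {\<omega>. Z \<omega> = z} \<noteq> {}" using assms by (auto simp: measure_pmf_zero_iff)
  have "pmf (cond_kernel P X Z z) x = measure (cond_pmf P {\<omega>. Z \<omega> = z}) {\<omega>. X \<omega> = x}"
    using ne by (simp add: cond_kernel_def pmf_map vimage_def)
  also have "\<dots> = measure P {\<omega>. X \<omega> = x \<and> Z \<omega> = z} / measure P {\<omega>. Z \<omega> = z}"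
    using ne by (simp add: cond_pmf.rep_eq emeasure_measure_pmf_not_zero Int_def conj_commute)
  finally show ?thesis by (simp add: cond_prob_def)
qed

lemma prob_sum_cases:
  fixes P :: "'o pmf" and Z :: "'o \<Rightarrow> 'c::finite"
  shows "\<P>(\<omega> in measure_pmf P. Q \<omega>) = (\<Sum>z\<in>UNIV. \<P>(\<omega> in P. Z \<omega> = z \<and> Q \<omega>))"
proof -
  have "{\<omega>. Q \<omega>} = (\<Union>z\<in>UNIV. {\<omega>. Z \<omega> = z \<and> Q \<omega>})" by auto
  then show ?thesis
    by (simp only: space_measure_pmf UNIV_I simp_thms)
       (intro measure_pmf.finite_measure_finite_Union, auto simp: disjoint_family_on_def)
qed

text \<open>Keeps both satellites and the joint output, as the factorization hypothesis does; the
  \<open>true_law\<close> of a receiver is an image of it.\<close>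

definition full_law where
  "full_law p0 p1 q1 p2 q2 ch = do {
     w0 \<leftarrow> p0; w1 \<leftarrow> p1 w0; x1 \<leftarrow> q1 w0 w1; w2 \<leftarrow> p2 w0; x2 \<leftarrow> q2 w0 w2;
     y \<leftarrow> ch x1 x2; return_pmf (w0, w1, x1, w2, x2, y)}"

lemma pmf_full_law:
  "pmf (full_law p0 p1 q1 p2 q2 ch) (a, b, c, d, e, y)
    = pmf p0 a * pmf (p1 a) b * pmf (q1 a b) c * pmf (p2 a) d * pmf (q2 a d) e * pmf (ch c e) y"
proof (rule pmf_ennreal_eqI)
  have "ennreal (pmf (full_law p0 p1 q1 p2 q2 ch) (a, b, c, d, e, y))
    = (\<integral>\<^sup>+z. indicator {(a, b, c, d, e, y)} z \<partial>full_law p0 p1 q1 p2 q2 ch)" by (rule ennreal_pmf_eq)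
  also have "\<dots> = ennreal (pmf p0 a * pmf (p1 a) b * pmf (q1 a b) c * pmf (p2 a) d * pmf (q2 a d) e * pmf (ch c e) y)"
    by (simp add: full_law_def del: nn_integral_indicator nn_integral_indicator_singleton)
       (simp add: law_pmf_simps del: nn_integral_indicator nn_integral_indicator_singleton)
  finally show "ennreal (pmf (full_law p0 p1 q1 p2 q2 ch) (a, b, c, d, e, y))
    = ennreal (pmf p0 a * pmf (p1 a) b * pmf (q1 a b) c * pmf (p2 a) d * pmf (q2 a d) e * pmf (ch c e) y)" .
qed simp

lemma map_full_law:
  "map_pmf (\<lambda>(w0, w1, x1, w2, x2, y). (w0, w1, x1, w2, f y)) (full_law p0 p1 q1 p2 q2 ch)
    = true_law p0 p1 q1 p2 q2 (\<lambda>a b. map_pmf f (ch a b))"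
  by (simp add: full_law_def true_law_def map_bind_pmf bind_map_pmf)

lemma pmf_map_prob: "pmf (map_pmf X P) x = \<P>(\<omega> in P. X \<omega> = x)"
  by (simp add: pmf_map vimage_def)

lemma joint_law:
  fixes P :: "'o pmf" and W0 :: "'o \<Rightarrow> 'w0" and W1 :: "'o \<Rightarrow> 'w1" and W2 :: "'o \<Rightarrow> 'w2"
    and X1 :: "'o \<Rightarrow> 'x1" and X2 :: "'o \<Rightarrow> 'x2" and Y :: "'o \<Rightarrow> 'y"
  assumes fact: "\<And>a b c d e y. \<P>(\<omega> in P. W0 \<omega> = a \<and> W1 \<omega> = b \<and> W2 \<omega> = d \<and> X1 \<omega> = c \<and> X2 \<omega> = e \<and> Y \<omega> = y) =
      \<P>(\<omega> in P. W0 \<omega> = a) * \<P>(\<omega> in P. W1 \<omega> = b \<bar> W0 \<omega> = a) * \<P>(\<omega> in P. W2 \<omega> = d \<bar> W0 \<omega> = a) *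
      \<P>(\<omega> in P. X1 \<omega> = c \<bar> W0 \<omega> = a \<and> W1 \<omega> = b) * \<P>(\<omega> in P. X2 \<omega> = e \<bar> W0 \<omega> = a \<and> W2 \<omega> = d) *
      pmf (ch c e) y"
  shows "map_pmf (\<lambda>\<omega>. (W0 \<omega>, W1 \<omega>, X1 \<omega>, W2 \<omega>, X2 \<omega>, Y \<omega>)) P =
    full_law (map_pmf W0 P) (cond_kernel P W1 W0) (\<lambda>a b. cond_kernel P X1 (W0 \<triangle> W1) (a, b))
      (cond_kernel P W2 W0) (\<lambda>a d. cond_kernel P X2 (W0 \<triangle> W2) (a, d)) ch"
proof (rule pmf_eqI)
  fix z :: "'w0 \<times> 'w1 \<times> 'x1 \<times> 'w2 \<times> 'x2 \<times> 'y"
  obtain a b c d e y where z: "z = (a, b, c, d, e, y)" by (cases z) auto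
  have lhs: "pmf (map_pmf (\<lambda>\<omega>. (W0 \<omega>, W1 \<omega>, X1 \<omega>, W2 \<omega>, X2 \<omega>, Y \<omega>)) P) z
    = \<P>(\<omega> in P. W0 \<omega> = a \<and> W1 \<omega> = b \<and> W2 \<omega> = d \<and> X1 \<omega> = c \<and> X2 \<omega> = e \<and> Y \<omega> = y)"
    by (simp add: pmf_map_prob z conj_ac)
  have k1: "pmf (cond_kernel P X1 (W0 \<triangle> W1) (a, b)) c = \<P>(\<omega> in P. X1 \<omega> = c \<bar> W0 \<omega> = a \<and> W1 \<omega> = b)"
    if "\<P>(\<omega> in P. W0 \<omega> = a \<and> W1 \<omega> = b) \<noteq> 0"
    using pmf_cond_kernel[where P = P and Z = "W0 \<triangle> W1" and z = "(a, b)" and X = X1 and x = c] that by simp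
  have k2: "pmf (cond_kernel P X2 (W0 \<triangle> W2) (a, d)) e = \<P>(\<omega> in P. X2 \<omega> = e \<bar> W0 \<omega> = a \<and> W2 \<omega> = d)"
    if "\<P>(\<omega> in P. W0 \<omega> = a \<and> W2 \<omega> = d) \<noteq> 0"
    using pmf_cond_kernel[where P = P and Z = "W0 \<triangle> W2" and z = "(a, d)" and X = X2 and x = e] that by simp
  show "pmf (map_pmf (\<lambda>\<omega>. (W0 \<omega>, W1 \<omega>, X1 \<omega>, W2 \<omega>, X2 \<omega>, Y \<omega>)) P) z =
    pmf (full_law (map_pmf W0 P) (cond_kernel P W1 W0) (\<lambda>a b. cond_kernel P X1 (W0 \<triangle> W1) (a, b))
      (cond_kernel P W2 W0) (\<lambda>a d. cond_kernel P X2 (W0 \<triangle> W2) (a, d)) ch) z"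
  \<comment> \<open>A conditional probability given a null event is 0, while
    \<open>cond_kernel\<close> is then an arbitrary point mass. The case distinctions show that
    whenever this happens another factor vanishes on both sides.\<close>
  proof (cases "\<P>(\<omega> in P. W0 \<omega> = a) = 0")
    case True
    then show ?thesis by (simp only: lhs fact) (simp add: z pmf_full_law pmf_map_prob)
  next
    case False
    note k = pmf_cond_kernel[OF False]
    show ?thesis
    proof (cases "\<P>(\<omega> in P. W0 \<omega> = a \<and> W1 \<omega> = b) = 0 \<or> \<P>(\<omega> in P. W0 \<omega> = a \<and> W2 \<omega> = d) = 0")
      case True
      then have "\<P>(\<omega> in P. W1 \<omega> = b \<bar> W0 \<omega> = a) = 0 \<or> \<P>(\<omega> in P. W2 \<omega> = d \<bar> W0 \<omega> = a) = 0"
        by (auto simp: cond_prob_def conj_commute)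
      then show ?thesis by (simp only: lhs fact) (auto simp: z pmf_full_law pmf_map_prob k)
    next
      case False
      then show ?thesis by (simp only: lhs fact) (simp add: z pmf_full_law pmf_map_prob k k1 k2 mult_ac)
    qed
  qed
qed

lemma common_source_law:
  fixes P :: "'o pmf" and S :: "'o \<Rightarrow> 's" and T :: "'o \<Rightarrow> 't" and K :: "'o \<Rightarrow> 'k"
  assumes indep: "\<And>s t k. \<P>(\<omega> in P. S \<omega> = s \<and> T \<omega> = t \<and> K \<omega> = k) =
      \<P>(\<omega> in P. S \<omega> = s) * \<P>(\<omega> in P. T \<omega> = t) * \<P>(\<omega> in P. K \<omega> = k)"
  shows "map_pmf ((S \<triangle> K) \<triangle> (T \<triangle> K)) P = common_source (map_pmf K P) (map_pmf S P) (map_pmf T P)"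
proof -
  have "map_pmf (K \<triangle> S \<triangle> T) P = pair_pmf (map_pmf K P) (pair_pmf (map_pmf S P) (map_pmf T P))"
  proof (rule pmf_eqI)
    fix z :: "'k \<times> 's \<times> 't"
    obtain k s t where z: "z = (k, s, t)" by (cases z) auto
    show "pmf (map_pmf (K \<triangle> S \<triangle> T) P) z = pmf (pair_pmf (map_pmf K P) (pair_pmf (map_pmf S P) (map_pmf T P))) z"
      using indep[of s t k] by (simp add: z pmf_pair pmf_map_prob conj_ac mult_ac)
  qed
  then have "map_pmf (\<lambda>(k, s, t). ((s, k), (t, k))) (map_pmf (K \<triangle> S \<triangle> T) P) =
    common_source (map_pmf K P) (map_pmf S P) (map_pmf T P)"
    by (simp add: common_source_def pair_pmf_def map_bind_pmf bind_assoc_pmf bind_return_pmf)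
  then show ?thesis by (simp add: map_pmf_comp)
qed

theorem corollary2:
  fixes P :: "'o pmf"
    and S' :: "'o \<Rightarrow> 'a::finite" and T' :: "'o \<Rightarrow> 'b::finite" and K :: "'o \<Rightarrow> 'k::finite"
    and W0 :: "'o \<Rightarrow> 'w0::finite" and W1 :: "'o \<Rightarrow> 'w1::finite" and W2 :: "'o \<Rightarrow> 'w2::finite"
    and X1 :: "'o \<Rightarrow> 'x1::finite" and X2 :: "'o \<Rightarrow> 'x2::finite"
    and Y1 :: "'o \<Rightarrow> 'y1::finite" and Y2 :: "'o \<Rightarrow> 'y2::finite"
    and ch :: "'x1 \<Rightarrow> 'x2 \<Rightarrow> ('y1 \<times> 'y2) pmf"
    and S :: "'o \<Rightarrow> 'a \<times> 'k" and T :: "'o \<Rightarrow> 'b \<times> 'k"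
  defines "S \<equiv> S' \<triangle> K" and "T \<equiv> T' \<triangle> K"
  assumes indep: "\<And>s' t' k. \<P>(\<omega> in P. S' \<omega> = s' \<and> T' \<omega> = t' \<and> K \<omega> = k) =
      \<P>(\<omega> in P. S' \<omega> = s') * \<P>(\<omega> in P. T' \<omega> = t') * \<P>(\<omega> in P. K \<omega> = k)"
    and factorization: "\<And>s' t' k w0 w1 w2 x1 x2 y1 y2.
      \<P>(\<omega> in P. S \<omega> = (s', k) \<and> T \<omega> = (t', k) \<and> W0 \<omega> = w0 \<and> W1 \<omega> = w1 \<and> W2 \<omega> = w2 \<and>
               X1 \<omega> = x1 \<and> X2 \<omega> = x2 \<and> Y1 \<omega> = y1 \<and> Y2 \<omega> = y2) =
      \<P>(\<omega> in P. S' \<omega> = s') * \<P>(\<omega> in P. T' \<omega> = t') * \<P>(\<omega> in P. K \<omega> = k) *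
      \<P>(\<omega> in P. W0 \<omega> = w0) *
      \<P>(\<omega> in P. W1 \<omega> = w1 \<bar> W0 \<omega> = w0) * \<P>(\<omega> in P. W2 \<omega> = w2 \<bar> W0 \<omega> = w0) *
      \<P>(\<omega> in P. X1 \<omega> = x1 \<bar> W0 \<omega> = w0 \<and> W1 \<omega> = w1) *
      \<P>(\<omega> in P. X2 \<omega> = x2 \<bar> W0 \<omega> = w0 \<and> W2 \<omega> = w2) *
      pmf (ch x1 x2) (y1, y2)"
    and "entropy_bits P S' < cond_mutual_info P X1 Y1 (W0 \<triangle> W2)"
    and "entropy_bits P T' < cond_mutual_info P X2 Y2 (W0 \<triangle> W1)"
    and "entropy_bits P K + entropy_bits P S' < mutual_info P (W0 \<triangle> W2 \<triangle> X1) Y1"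
    and "entropy_bits P K + entropy_bits P T' < mutual_info P (W0 \<triangle> W1 \<triangle> X2) Y2"
    and "entropy_bits P S' + entropy_bits P T' <
      cond_mutual_info P X1 Y1 (W0 \<triangle> W1 \<triangle> W2) + cond_mutual_info P (W1 \<triangle> X2) Y2 W0"
    and "entropy_bits P S' + entropy_bits P T' <
      cond_mutual_info P X2 Y2 (W0 \<triangle> W1 \<triangle> W2) + cond_mutual_info P (W2 \<triangle> X1) Y1 W0"
    and "entropy_bits P S' + entropy_bits P T' <
      cond_mutual_info P (W2 \<triangle> X1) Y1 (W0 \<triangle> W1) + cond_mutual_info P (W1 \<triangle> X2) Y2 (W0 \<triangle> W2)"
    and "entropy_bits P K + entropy_bits P S' + entropy_bits P T' <
      mutual_info P (W0 \<triangle> W1 \<triangle> X2) Y2 + cond_mutual_info P X1 Y1 (W0 \<triangle> W1 \<triangle> W2)"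
    and "entropy_bits P K + entropy_bits P S' + entropy_bits P T' <
      mutual_info P (W0 \<triangle> W2 \<triangle> X1) Y1 + cond_mutual_info P X2 Y2 (W0 \<triangle> W1 \<triangle> W2)"
    and "2 * entropy_bits P S' + entropy_bits P T' <
      cond_mutual_info P X1 Y1 (W0 \<triangle> W1 \<triangle> W2) + cond_mutual_info P (W2 \<triangle> X1) Y1 W0 +
      cond_mutual_info P (W1 \<triangle> X2) Y2 (W0 \<triangle> W2)"
    and "entropy_bits P S' + 2 * entropy_bits P T' <
      cond_mutual_info P X2 Y2 (W0 \<triangle> W1 \<triangle> W2) + cond_mutual_info P (W1 \<triangle> X2) Y2 W0 +
      cond_mutual_info P (W2 \<triangle> X1) Y1 (W0 \<triangle> W1)"
    and "entropy_bits P K + 2 * entropy_bits P S' + entropy_bits P T' <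
      cond_mutual_info P X1 Y1 (W0 \<triangle> W1 \<triangle> W2) + mutual_info P (W0 \<triangle> W2 \<triangle> X1) Y1 +
      cond_mutual_info P (W1 \<triangle> X2) Y2 (W0 \<triangle> W2)"
    and "entropy_bits P K + entropy_bits P S' + 2 * entropy_bits P T' <
      cond_mutual_info P X2 Y2 (W0 \<triangle> W1 \<triangle> W2) + mutual_info P (W0 \<triangle> W1 \<triangle> X2) Y2 +
      cond_mutual_info P (W2 \<triangle> X1) Y1 (W0 \<triangle> W1)"
  shows "admissible (map_pmf (S \<triangle> T) P) ch"
proof -
  have sum_one: "(\<Sum>z\<in>UNIV. \<P>(\<omega> in P. Z \<omega> = z)) = 1" for Z :: "'o \<Rightarrow> 'z::finite"
    using prob_sum_cases[of P "\<lambda>_. True" Z] by simp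
  \<comment> \<open>Summing the factorization over the values of the three sources removes them,
    since the probabilities of each sum to 1.\<close>
  have fact: "\<P>(\<omega> in P. W0 \<omega> = a \<and> W1 \<omega> = b \<and> W2 \<omega> = d \<and> X1 \<omega> = c \<and> X2 \<omega> = e \<and> (Y1 \<triangle> Y2) \<omega> = y) =
      \<P>(\<omega> in P. W0 \<omega> = a) * \<P>(\<omega> in P. W1 \<omega> = b \<bar> W0 \<omega> = a) * \<P>(\<omega> in P. W2 \<omega> = d \<bar> W0 \<omega> = a) *
      \<P>(\<omega> in P. X1 \<omega> = c \<bar> W0 \<omega> = a \<and> W1 \<omega> = b) * \<P>(\<omega> in P. X2 \<omega> = e \<bar> W0 \<omega> = a \<and> W2 \<omega> = d) *
      pmf (ch c e) y" (is "\<P>(\<omega> in P. ?Q \<omega>) = ?M") for a b c d e y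
  proof -
    obtain y1 y2 where y: "y = (y1, y2)" by (cases y)
    have "\<P>(\<omega> in P. ?Q \<omega>) = (\<Sum>s\<in>UNIV. \<Sum>t\<in>UNIV. \<Sum>k\<in>UNIV. \<P>(\<omega> in P. K \<omega> = k \<and> T' \<omega> = t \<and> S' \<omega> = s \<and> ?Q \<omega>))"
      by (subst prob_sum_cases[where Z = S'], subst prob_sum_cases[where Z = T'], subst prob_sum_cases[where Z = K]) (rule refl)
    also have "\<dots> = (\<Sum>s\<in>UNIV. \<Sum>t\<in>UNIV. \<Sum>k\<in>UNIV.
        \<P>(\<omega> in P. S' \<omega> = s) * (\<P>(\<omega> in P. T' \<omega> = t) * (\<P>(\<omega> in P. K \<omega> = k) * ?M)))"
    proof (intro sum.cong refl)
      fix s t k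
      have "(K \<omega> = k \<and> T' \<omega> = t \<and> S' \<omega> = s \<and> ?Q \<omega>) \<longleftrightarrow>
        (S \<omega> = (s, k) \<and> T \<omega> = (t, k) \<and> W0 \<omega> = a \<and> W1 \<omega> = b \<and> W2 \<omega> = d \<and>
               X1 \<omega> = c \<and> X2 \<omega> = e \<and> Y1 \<omega> = y1 \<and> Y2 \<omega> = y2)" for \<omega>
        by (auto simp: S_def T_def y)
      then have "\<P>(\<omega> in P. K \<omega> = k \<and> T' \<omega> = t \<and> S' \<omega> = s \<and> ?Q \<omega>) =
        \<P>(\<omega> in P. S \<omega> = (s, k) \<and> T \<omega> = (t, k) \<and> W0 \<omega> = a \<and> W1 \<omega> = b \<and> W2 \<omega> = d \<and>
               X1 \<omega> = c \<and> X2 \<omega> = e \<and> Y1 \<omega> = y1 \<and> Y2 \<omega> = y2)" by simp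
      also note factorization
      finally show "\<P>(\<omega> in P. K \<omega> = k \<and> T' \<omega> = t \<and> S' \<omega> = s \<and> ?Q \<omega>) =
        \<P>(\<omega> in P. S' \<omega> = s) * (\<P>(\<omega> in P. T' \<omega> = t) * (\<P>(\<omega> in P. K \<omega> = k) * ?M))"
        by (simp add: y mult.assoc)
    qed
    also have "\<dots> = ?M"
      by (simp only: sum_distrib_left[symmetric] sum_distrib_right[symmetric] sum_one mult_1)
    finally show ?thesis .
  qed
  define p0 where "p0 = map_pmf W0 P"
  define p1 where "p1 = cond_kernel P W1 W0"
  define p2 where "p2 = cond_kernel P W2 W0"
  define q1 where "q1 a b = cond_kernel P X1 (W0 \<triangle> W1) (a, b)" for a b
  define q2 where "q2 a d = cond_kernel P X2 (W0 \<triangle> W2) (a, d)" for a d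
  note defs = p0_def p1_def p2_def q1_def[abs_def] q2_def[abs_def]
  have "map_pmf (\<lambda>\<omega>. (W0 \<omega>, W1 \<omega>, X1 \<omega>, W2 \<omega>, X2 \<omega>, (Y1 \<triangle> Y2) \<omega>)) P = full_law p0 p1 q1 p2 q2 ch"
    unfolding defs by (rule joint_law[OF fact])
  from arg_cong[OF this, of "map_pmf (\<lambda>(w0, w1, x1, w2, x2, y). (w0, w1, x1, w2, fst y))"]
  have law1: "map_pmf (\<lambda>\<omega>. (W0 \<omega>, W1 \<omega>, X1 \<omega>, W2 \<omega>, Y1 \<omega>)) P = true_law p0 p1 q1 p2 q2 (\<lambda>a b. map_pmf fst (ch a b))"
    by (simp add: map_full_law map_pmf_comp)
  \<comment> \<open>The factorization is symmetric in the users, so receiver 2 sees a law of the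
    same kind with their roles and the channel arguments exchanged.\<close>
  have "map_pmf (\<lambda>\<omega>. (W0 \<omega>, W2 \<omega>, X2 \<omega>, W1 \<omega>, X1 \<omega>, (Y1 \<triangle> Y2) \<omega>)) P = full_law p0 p2 q2 p1 q1 (\<lambda>b a. ch a b)"
    unfolding defs by (rule joint_law) (use fact in \<open>simp add: conj_ac mult_ac\<close>)
  from arg_cong[OF this, of "map_pmf (\<lambda>(w0, w1, x1, w2, x2, y). (w0, w1, x1, w2, snd y))"]
  have law2: "map_pmf (\<lambda>\<omega>. (W0 \<omega>, W2 \<omega>, X2 \<omega>, W1 \<omega>, Y2 \<omega>)) P = true_law p0 p2 q2 p1 q1 (\<lambda>b a. map_pmf snd (ch a b))"
    by (simp add: map_full_law map_pmf_comp)
  have flip: "cond_mutual_info P X2 Y2 (W0 \<triangle> W2 \<triangle> W1) = cond_mutual_info P X2 Y2 (W0 \<triangle> W1 \<triangle> W2)"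
    unfolding cond_mutual_info_entropy
    by (intro arg_cong2[where f = "(-)"] arg_cong2[where f = "(+)"] entropy_bits_cong; auto)
  define D1 where "D1 i = divergence (true_law p0 p1 q1 p2 q2 (\<lambda>a b. map_pmf fst (ch a b)))
      (wrong_law i p0 p1 q1 p2 q2 (\<lambda>a b. map_pmf fst (ch a b)))" for i
  define D2 where "D2 i = divergence (true_law p0 p2 q2 p1 q1 (\<lambda>b a. map_pmf snd (ch a b)))
      (wrong_law i p0 p2 q2 p1 q1 (\<lambda>b a. map_pmf snd (ch a b)))" for i
  note D1 = information_le_divergences[OF law1, folded D1_def]
    and D2 = information_le_divergences[OF law2, unfolded flip, folded D2_def]
  let ?hS = "entropy_bits P S'" and ?hT = "entropy_bits P T'" and ?hK = "entropy_bits P K"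
  \<comment> \<open>The hypotheses bound the rates by informations and remain true for the
    divergences, which are at least as large. \<open>d1\<close> and \<open>d2\<close> do not occur
    in the conclusion of \<open>fourier_motzkin\<close>, hence their explicit instances.\<close>
  have "\<exists>u v. 0 \<le> u \<and> 0 \<le> v \<and> ?hS - u < D1 (Some (True, True)) \<and> ?hS + v - u < D1 (Some (True, False))
    \<and> ?hS + v < D1 (Some (False, False)) \<and> ?hK + ?hS + v < D1 None
    \<and> ?hT - v < D2 (Some (True, True)) \<and> ?hT + u - v < D2 (Some (True, False))
    \<and> ?hT + u < D2 (Some (False, False)) \<and> ?hK + ?hT + u < D2 None"
    by (rule fourier_motzkin[where ?d1.0 = "D1 (Some (False, True))" and ?d2.0 = "D2 (Some (False, True))"])
      (use D1 D2 assms(5-) in linarith)+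
  then obtain u v where uv: "0 \<le> u" "0 \<le> v" "?hS - u < D1 (Some (True, True))" "?hS + v - u < D1 (Some (True, False))"
    "?hS + v < D1 (Some (False, False))" "?hK + ?hS + v < D1 None"
    "?hT - v < D2 (Some (True, True))" "?hT + u - v < D2 (Some (True, False))"
    "?hT + u < D2 (Some (False, False))" "?hK + ?hT + u < D2 None" by blast
  have d: "?hS < D1 (Some (False, True))" "?hT < D2 (Some (False, True))"
    using D1 D2 assms(5-) by linarith+
  note rates = uv(3-)[unfolded entropy_bits_shannon D1_def D2_def] d[unfolded entropy_bits_shannon D1_def D2_def]
  have "admissible (common_source (map_pmf K P) (map_pmf S' P) (map_pmf T' P)) ch"
    by (intro admissible_common_source[where ?p0.0 = p0 and ?p1.0 = p1 and ?q1.0 = q1 and ?p2.0 = p2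
          and ?q2.0 = q2, OF uv(1,2)] rates)
  then show ?thesis
    using common_source_law[OF indep] unfolding S_def T_def by simp
qed

end
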